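(* For every integer $\ell>5$ with $5\nmid \ell$ and $\ell\notin\{7,8,13\}$, $\mathrm{ex}(n,\overrightarrow{C}_5,\overrightarrow{C}_\ell)=\left(\frac{n}{5}\right)^5+o(n^5)$.
   Context: An oriented graph is a directed graph without loops in which every pair of vertices is joined by at most one arc. $\overrightarrow{C}_m$ denotes the directed cycle of length $m$. A copy of $H$ in $G$ is a (not necessarily induced) subgraph isomorphic to $H$. $\mathrm{ex}(n,\overrightarrow{C}_k,\overrightarrow{C}_\ell)$ is the maximum number of copies of $\overrightarrow{C}_k$ in an $n$-vertex oriented graph containing no copy of $\overrightarrow{C}_\ell$. Asymptotics are as $n\to\infty$ with $\ell$ fixed. *)

theory Defs
  imports Complex_Main "HOL-Library.Landau_Symbols" "Graph_Theory.Digraph_Isomorphism"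
begin

definition oriented_graph :: "'a pair_pre_digraph \<Rightarrow> bool" where
  "oriented_graph G \<longleftrightarrow>
     pair_digraph G \<and> (\<forall>u v. (u, v) \<in> parcs G \<longrightarrow> (v, u) \<notin> parcs G)"

definition dcycle :: "nat \<Rightarrow> nat pair_pre_digraph" where
  "dcycle m = \<lparr> pverts = {..<m}, parcs = {(i, Suc i mod m) | i. i < m} \<rparr>"

definition copies :: "'b pair_pre_digraph \<Rightarrow> 'a pair_pre_digraph \<Rightarrow> 'a pair_pre_digraph set" where
  "copies H G =
     {K. subgraph (with_proj K) (with_proj G) \<and> digraph_iso (with_proj H) (with_proj K)}"

text \<open>
  Taking the vertices to be natural numbers is no restriction, as every finite graph is isomorphic
  to one of this kind. The maximum is over a finite set, which is nonempty if \<open>F\<close> has an arc;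
  see \<open>finite_copy_counts\<close> and \<open>copy_counts_nonempty\<close> below.
\<close>

definition copy_counts ::
    "nat \<Rightarrow> 'b pair_pre_digraph \<Rightarrow> 'c pair_pre_digraph \<Rightarrow> nat set" where
  "copy_counts n H F =
     {card (copies H G) | G :: nat pair_pre_digraph.
        oriented_graph G \<and> card (pverts G) = n \<and> copies F G = {}}"

definition ex_oriented :: "nat \<Rightarrow> 'b pair_pre_digraph \<Rightarrow> 'c pair_pre_digraph \<Rightarrow> nat" where
  "ex_oriented n H F = Max (copy_counts n H F)"

lemma copies_subset:
  "copies H G \<subseteq> (\<lambda>(V, A). \<lparr>pverts = V, parcs = A\<rparr>) ` (Pow (pverts G) \<times> Pow (parcs G))"
proof
  fix K assume "K \<in> copies H G"
  then have "pverts K \<subseteq> pverts G" "parcs K \<subseteq> parcs G"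
    by (auto simp: copies_def subgraph_def with_proj_def)
  then show "K \<in> (\<lambda>(V, A). \<lparr>pverts = V, parcs = A\<rparr>) ` (Pow (pverts G) \<times> Pow (parcs G))"
    by (intro image_eqI[where x = "(pverts K, parcs K)"]) auto
qed

lemma finite_copies:
  assumes "oriented_graph G"
  shows "finite (copies H G)"
proof -
  interpret pair_digraph G using assms by (simp add: oriented_graph_def)
  show ?thesis
    by (rule finite_subset[OF copies_subset]) (simp add: pair_finite_verts pair_finite_arcs)
qed

lemma finite_copy_counts: "finite (copy_counts n H F)"
proof (rule finite_subset)
  show "copy_counts n H F \<subseteq> {..2 ^ n * 2 ^ (n * n)}"
  proof
    fix c assume "c \<in> copy_counts n H F"
    then obtain G :: "nat pair_pre_digraph" where G: "oriented_graph G" "card (pverts G) = n"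
      and c: "c = card (copies H G)"
      by (auto simp: copy_counts_def)
    interpret pair_digraph G using G by (simp add: oriented_graph_def)
    have sub: "parcs G \<subseteq> pverts G \<times> pverts G"
      using arc_fst_in_verts arc_snd_in_verts by fastforce
    have fin: "finite (pverts G)" "finite (parcs G)"
      using pair_finite_verts pair_finite_arcs by auto
    have "card (parcs G) \<le> n * n"
      using card_mono[OF _ sub] fin G by (simp add: card_cartesian_product)
    then have "(2::nat) ^ n * 2 ^ card (parcs G) \<le> 2 ^ n * 2 ^ (n * n)"
      by (intro mult_le_mono2 power_increasing) auto
    moreover have "c \<le> card (Pow (pverts G) \<times> Pow (parcs G))"
      unfolding c by (rule surj_card_le[OF _ copies_subset]) (simp add: fin)
    then have "c \<le> 2 ^ n * 2 ^ card (parcs G)"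
      using fin G by (simp add: card_cartesian_product card_Pow)
    ultimately show "c \<in> {..2 ^ n * 2 ^ (n * n)}"
      unfolding atMost_iff by (rule le_trans[rotated])
  qed
qed simp

lemma copy_counts_nonempty:
  assumes "parcs F \<noteq> {}"
  shows "copy_counts n H F \<noteq> {}"
proof -
  let ?G = "\<lparr>pverts = {..<n}, parcs = {}\<rparr> :: nat pair_pre_digraph"
  have "oriented_graph ?G"
    by (auto simp: oriented_graph_def) (unfold_locales, auto)
  moreover have "copies F ?G = {}"
    using assms
    by (auto simp: copies_def subgraph_def digraph_iso_def app_iso_def with_proj_def)
  ultimately have "card (copies H ?G) \<in> copy_counts n H F"
    unfolding copy_counts_def by (intro CollectI exI[of _ ?G]) auto
  then show ?thesis by blast
qed

end

theory Submission
  imports Defs "HOL-Analysis.Convex"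
begin

text \<open>
  The lower bound is the balanced blow-up of the directed 5-cycle, whose closed walks all have length
  divisible by 5.

  For the upper bound, first suppose that there is no closed walk of length \<open>l\<close> at all. Sample the
  vertices of a 5-cycle one after another, each uniformly among the candidates compatible with
  the previous ones; the probabilities of the 5-cycles sum to at most 1. Fix a 5-cycle and add up
  the sizes of the four candidate sets over its five rotations. If some vertex were counted more
  than 4 times, it would lie on closed walks whose lengths generate \<open>l\<close> (this is where 7, 8 and 13
  are exceptional), so the 20 sizes sum to at most \<open>4 n\<close>. The AM-GM inequality then bounds the
  number of closed 5-walks by \<open>n (n / 5)^4\<close>.

  A graph without a directed \<open>l\<close>-cycle can still have closed walks of length \<open>l\<close>, but only
  \<open>o(n^l)\<close> of them. By repeated use of Cauchy--Schwarz the same holds for every way in which such a walk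
  may repeat vertices, so the pullback of the graph along a random map from a bounded number
  of points has no closed walk of length \<open>l\<close> with probability tending to 1. Averaging over
  these pullbacks carries the bound over; no removal lemma is needed.
\<close>

section \<open>Phases of a vertex relative to a closed 5-walk\<close>

lemma relpow_closed_mult:
  assumes "(w, w) \<in> E ^^ a"
  shows "(w, w) \<in> E ^^ (a * k)"
proof (induction k)
  case (Suc k)
  then have "(w, w) \<in> E ^^ a O E ^^ (a * k)" using assms by blast
  then show ?case by (simp add: relpow_add)
qed simp

lemma relpow_closed_add:
  assumes "(w, w) \<in> E ^^ a" "(w, w) \<in> E ^^ b"
  shows "(w, w) \<in> E ^^ (a + b)"
  using assms by (auto simp: relpow_add)

text \<open>A vertex \<open>w\<close> has phase \<open>p\<close> with respect to a closed 5-walk \<open>v\<close> if it can stand in for \<open>v p\<close>: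
  it is reached from \<open>v (p - s)\<close> in \<open>s\<close> steps and reaches \<open>v (p + t)\<close> in \<open>t\<close> steps. Two different
  phases of the same \<open>w\<close> produce closed walks through \<open>w\<close> of lengths not divisible by 5.\<close>

definition walk_phase :: "'a rel \<Rightarrow> (int \<Rightarrow> 'a) \<Rightarrow> 'a \<Rightarrow> int \<Rightarrow> nat \<Rightarrow> nat \<Rightarrow> bool" where
  "walk_phase E v w p s t \<longleftrightarrow> (v (p - int s), w) \<in> E ^^ s \<and> (w, v (p + int t)) \<in> E ^^ t"

locale cyclic_5_walk =
  fixes E :: "'a rel" and v :: "int \<Rightarrow> 'a"
  assumes arc: "(v i, v (i + 1)) \<in> E" and periodic: "v (i + 5) = v i"
begin

lemma walk: "(v i, v (i + int n)) \<in> E ^^ n"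
proof (induction n)
  case (Suc n)
  have "(v (i + int n), v (i + int (Suc n))) \<in> E"
    using arc[of "i + int n"] by (simp add: algebra_simps)
  with Suc show ?case by auto
qed simp

lemma periodic_mult: "v (i + 5 * int k) = v i"
proof (induction k)
  case (Suc k)
  have "v (i + 5 * int (Suc k)) = v ((i + 5 * int k) + 5)" by (simp add: algebra_simps)
  then show ?case using Suc by (simp only: periodic)
qed simp

lemma periodic_dvd:
  assumes "5 dvd (j - i)"
  shows "v j = v i"
proof (cases "i \<le> j")
  case True
  from assms obtain k where "j - i = 5 * k" by (elim dvdE)
  with True have "j = i + 5 * int (nat k)" by simp
  then show ?thesis by (simp only: periodic_mult)
next
  case False
  from assms obtain k where "j - i = 5 * k" by (elim dvdE)
  with False have "i = j + 5 * int (nat (- k))" by simp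
  then show ?thesis by (metis periodic_mult)
qed

lemma walk_phase_periodic: "walk_phase E v w (p + 5) s t = walk_phase E v w p s t"
proof -
  have "v (p + 5 - int s) = v (p - int s)" "v (p + 5 + int t) = v (p + int t)"
    by (auto intro!: periodic_dvd)
  then show ?thesis by (simp add: walk_phase_def)
qed

text \<open>The closed walk leaves \<open>w\<close> for \<open>v (p + t)\<close>, follows
  \<open>v\<close> for \<open>k\<close> steps to \<open>v (q - s')\<close> and returns to
  \<open>w\<close>. As \<open>v\<close> has period 5, only the residue of \<open>k\<close> modulo 5
  is prescribed, so only the residue of \<open>n\<close> and the lower bound \<open>t + s'\<close>
  matter.\<close>

lemma closed_walk_between_phases:
  assumes "walk_phase E v w p s t" "walk_phase E v w q s' t'"
    and "n \<ge> t + s'" "5 dvd (int n - (q - p))"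
  shows "(w, w) \<in> E ^^ n"
proof -
  obtain k where k: "n = t + k + s'" using assms(3) by (metis add.assoc add.commute le_Suc_ex)
  have "v (p + int t + int k) = v (q - int s')"
    using assms(4) by (intro periodic_dvd) (simp add: k algebra_simps)
  then have "(v (p + int t), v (q - int s')) \<in> E ^^ k" by (metis walk)
  with assms(1,2) show ?thesis unfolding k walk_phase_def relpow_add by auto
qed

lemma walk_phase_mono:
  assumes "walk_phase E v w p s t" "s \<le> s'" "t \<le> t'"
  shows "walk_phase E v w p s' t'"
proof -
  obtain a b where ab: "s' = a + s" "t' = t + b"
    using assms(2,3) by (metis add.commute le_Suc_ex)
  have "(v (p - int s'), v (p - int s)) \<in> E ^^ a"
    using walk[of "p - int s'" a] by (simp add: ab)
  moreover have "(v (p + int t), v (p + int t')) \<in> E ^^ b"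
    using walk[of "p + int t" b] by (simp add: ab algebra_simps)
  ultimately show ?thesis
    using assms(1) unfolding walk_phase_def ab relpow_add by blast
qed

end

locale oriented_no_closed_walk =
  fixes E :: "'a rel" and l :: nat
  assumes asym: "(u, w) \<in> E \<Longrightarrow> (w, u) \<notin> E"
    and length: "l > 5" "\<not> 5 dvd l" "l \<notin> {7, 8, 13}"
    and no_closed_walk: "(w, w) \<notin> E ^^ l"
begin

lemma no_closed_2_walk: "(w, w) \<notin> E ^^ 2"
  using asym by (auto simp: numeral_2_eq_2)

text \<open>Closed walks at one vertex concatenate. The only numbers that are not sums of 3s and 5s
  are 1, 2, 4 and 7, so \<open>l\<close> is such a sum.\<close>

lemma no_closed_5_3_walk:
  assumes "(w, w) \<in> E ^^ 5" "(w, w) \<in> E ^^ 3"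
  shows False
proof -
  have "\<exists>a b. l = 5 * a + 3 * b" using length by simp presburger
  then obtain a b where "l = 5 * a + 3 * b" by blast
  then show False
    using relpow_closed_add[OF relpow_closed_mult[OF assms(1), of a] relpow_closed_mult[OF assms(2), of b]]
      no_closed_walk by simp
qed

text \<open>The numbers that are not sums of 5s, 6s and 9s are 1, 2, 3, 4, 7, 8 and 13; those above
  5 are exactly the three exceptional lengths.\<close>

lemma no_closed_5_6_9_walk:
  assumes "(w, w) \<in> E ^^ 5" "(w, w) \<in> E ^^ 6" "(w, w) \<in> E ^^ 9"
  shows False
proof -
  obtain k r where kr: "l = 5 * k + r" "r < 5"
    using that[of "l div 5" "l mod 5"] by simp
  have "r \<noteq> 0" using length(2) kr(1) by (intro notI) simp
  with kr(2) consider "r = 1" | "r = 2" | "r = 3" | "r = 4" by linarith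
  \<comment> \<open>The least sums in the residue classes 1, 2, 3, 4 modulo 5 are 6, 6 + 6, 9 + 9
    and 9; the rest of \<open>l\<close> is filled up with 5s.\<close>
  then have "\<exists>a b c. l = 5 * a + 6 * b + 9 * c"
  proof cases
    case 1
    have "k \<noteq> 0" using kr length \<open>r = 1\<close> by auto
    with \<open>r = 1\<close> kr have "l = 5 * (k - 1) + 6 * 1 + 9 * 0" by simp
    then show ?thesis by blast
  next
    case 2
    have "k \<noteq> 0" "k \<noteq> 1" using kr length \<open>r = 2\<close> by auto
    with \<open>r = 2\<close> kr have "l = 5 * (k - 2) + 6 * 2 + 9 * 0" by simp
    then show ?thesis by blast
  next
    case 3
    have "k \<noteq> 0" "k \<noteq> 1" "k \<noteq> 2" using kr length \<open>r = 3\<close> by auto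
    with \<open>r = 3\<close> kr have "l = 5 * (k - 3) + 6 * 0 + 9 * 2" by simp
    then show ?thesis by blast
  next
    case 4
    have "k \<noteq> 0" using kr length \<open>r = 4\<close> by auto
    with \<open>r = 4\<close> kr have "l = 5 * (k - 1) + 6 * 0 + 9 * 1" by simp
    then show ?thesis by blast
  qed
  then obtain a b c where "l = 5 * a + 6 * b + 9 * c" by blast
  then show False
    using relpow_closed_add[OF relpow_closed_add[OF relpow_closed_mult[OF assms(1), of a]
        relpow_closed_mult[OF assms(2), of b]] relpow_closed_mult[OF assms(3), of c]]
      no_closed_walk by simp
qed

end

locale cycle_in_oriented = cyclic_5_walk E v + oriented_no_closed_walk E l
  for E :: "'a rel" and v l
begin

abbreviation phase where "phase \<equiv> walk_phase E v"

lemma phase_closed_5: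
  assumes "phase w p s t" "s + t \<le> 5"
  shows "(w, w) \<in> E ^^ 5"
  using closed_walk_between_phases[OF assms(1) assms(1), of 5] assms(2) by (simp add: add.commute)

text \<open>Otherwise \<open>w\<close> lies on a closed 6-walk from phase \<open>p\<close> to
  \<open>p + 1\<close> and on a closed 9-walk back. The latter is long enough, because
  \<open>s + t + s' + t' \<le> 10\<close> and \<open>t + s' \<ge> 2\<close> give
  \<open>t' + s \<le> 8\<close>.\<close>

lemma adjacent_phases:
  assumes "phase w p s t" "phase w (p + 1) s' t'" "s + t \<le> 5" "s' + t' \<le> 5" "t + s' \<ge> 2"
  shows "t + s' \<ge> 7"
proof (rule ccontr)
  assume "\<not> t + s' \<ge> 7"
  then have "(w, w) \<in> E ^^ 6"
    using closed_walk_between_phases[OF assms(1,2), of 6] by simp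
  moreover have "(w, w) \<in> E ^^ 9"
    using closed_walk_between_phases[OF assms(2,1), of 9] assms(3-) by simp
  ultimately show False
    using no_closed_5_6_9_walk phase_closed_5[OF assms(1,3)] by blast
qed

text \<open>Passing from phase \<open>p\<close> to \<open>p + 2\<close> takes 2 steps modulo 5, and
  passing back takes 3. Too short a passage gives a closed 2-walk, which asymmetry forbids, or a
  closed 3-walk next to the closed 5-walk.\<close>

lemma distant_phases:
  assumes "phase w p s t" "phase w (p + 2) s' t'" "s + t \<le> 5"
  shows "t + s' \<ge> 3" "t' + s \<ge> 4"
proof -
  show "t + s' \<ge> 3"
    using closed_walk_between_phases[OF assms(1,2), of 2] no_closed_2_walk by (intro leI notI) auto
  show "t' + s \<ge> 4"
    using closed_walk_between_phases[OF assms(2,1), of 3] no_closed_5_3_walk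
      phase_closed_5[OF assms(1,3)] by (intro leI notI) auto
qed

lemma phase_1_1:
  assumes "phase w p 1 t" "phase w p s 1"
  shows "phase w p 1 1"
  using assms by (auto simp: walk_phase_def)

text \<open>The bound 4 is what a vertex \<open>v p\<close> of the walk itself attains, having all
  four kinds at phase \<open>p\<close>. The proof is a finite check of which kinds exclude each
  other at phases one or two apart.\<close>

lemma phase_count:
  "(\<Sum>p\<in>{0, 1, 2, 3, 4}. of_bool (phase w p 1 4) + of_bool (phase w p 3 1)
      + of_bool (phase w p 1 2) + of_bool (phase w p 1 1)) \<le> (4 :: nat)"
proof -
  define a where "a p \<longleftrightarrow> phase w p 1 4" for p
  define b where "b p \<longleftrightarrow> phase w p 3 1" for p
  define c where "c p \<longleftrightarrow> phase w p 1 2" for p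
  define d where "d p \<longleftrightarrow> phase w p 1 1" for p
  note defs = a_def b_def c_def d_def
  \<comment> \<open>For \<open>a p\<close> and \<open>b (p + 1)\<close> the relevant sum is
    \<open>4 + 3 = 7\<close>, which \<open>adjacent_phases\<close> permits. Among \<open>a\<close>
    and \<open>b\<close> this is the only pair at neighbouring phases that is not excluded.\<close>
  have adj: "\<not> (a p \<and> a (p + 1))" "\<not> (b p \<and> b (p + 1))" "\<not> (b p \<and> a (p + 1))" 
    "\<not> (c p \<and> b (p + 1))" for p
    unfolding defs using adjacent_phases[of w p _ _ ] by fastforce+
  have dist: "\<not> (a p \<and> b (p + 2))" "\<not> (a p \<and> c (p + 2))" "\<not> (b p \<and> a (p + 2))" for p
    unfolding defs using distant_phases[of w p] by fastforce+
  have impl: "c p \<Longrightarrow> a p" "d p \<longleftrightarrow> a p \<and> b p" "d p \<Longrightarrow> c p" for p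
    unfolding defs using phase_1_1 by (auto elim: walk_phase_mono)
  have per: "a (p + 5) = a p" "b (p + 5) = b p" "c (p + 5) = c p" "d (p + 5) = d p" for p
    unfolding defs by (rule walk_phase_periodic)+
  define f :: "int \<Rightarrow> nat"
    where "f p = of_bool (a p) + of_bool (b p) + of_bool (c p) + of_bool (d p)" for p
  have f_per: "f (p + 5) = f p" for p
    by (simp only: f_def per)
  have f_0: "f p = 0" if "\<not> a p" "\<not> b p" for p
    using that impl[of p] by (auto simp: f_def)
  have total: "(\<Sum>q\<in>{0, 1, 2, 3, 4}. f q) = f p + f (p + 1) + f (p + 2) + f (p + 3) + f (p + 4)"
    if "p \<in> {0, 1, 2, 3, 4}" for p
    using that f_per[of 0] f_per[of 1] f_per[of 2] f_per[of 3] by auto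
  have adj': "\<not> (a (p + 4) \<and> a p)" "\<not> (b (p + 4) \<and> b p)" "\<not> (b (p + 4) \<and> a p)"
      "\<not> (c (p + 4) \<and> b p)" for p
    using adj[of "p + 4"] per[of p] by (simp_all add: add.commute)
  have dist': "\<not> (a (p + 3) \<and> b p)" "\<not> (a (p + 3) \<and> c p)" "\<not> (b (p + 3) \<and> a p)" for p
    using dist[of "p + 3"] per[of p] by (simp_all add: add.commute)
  consider (full) p where "p \<in> {0, 1, 2, 3, 4}" "d p"
    | (half) p where "p \<in> {0, 1, 2, 3, 4}" "c p" "\<not> d p"
    | (rest) "\<And>p. p \<in> {0, 1, 2, 3, 4} \<Longrightarrow> \<not> c p \<and> \<not> d p"
    by blast
  then have "(\<Sum>q\<in>{0, 1, 2, 3, 4}. f q) \<le> 4"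
  proof cases
    case full
    \<comment> \<open>\<open>a\<close> and \<open>b\<close> together at \<open>p\<close> exclude
      both of them at every other phase, so only \<open>f p\<close> is left.\<close>
    have "\<not> a (p + 1) \<and> \<not> b (p + 1)" "\<not> a (p + 2) \<and> \<not> b (p + 2)"
      "\<not> a (p + 3) \<and> \<not> b (p + 3)" "\<not> a (p + 4) \<and> \<not> b (p + 4)"
      using full(2) impl(2)[of p] adj[of p] adj'[of p] dist[of p] dist'[of p] by blast+
    then have "f (p + 1) = 0" "f (p + 2) = 0" "f (p + 3) = 0" "f (p + 4) = 0"
      by (auto intro: f_0)
    moreover have "f p \<le> 4" by (simp add: f_def)
    ultimately show ?thesis unfolding total[OF full(1)] by linarith
  next
    case half
    \<comment> \<open>Only \<open>a\<close> and \<open>c\<close> hold at \<open>p\<close>, since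
      \<open>b p\<close> would give \<open>d p\<close>. Phases \<open>p + 1\<close> and
      \<open>p + 4\<close> vanish, and at most one of \<open>p + 2\<close> and \<open>p + 3\<close>
      survives, contributing at most 2.\<close>
    have ab: "a p" "\<not> b p" using half(2,3) impl[of p] by blast+
    have "\<not> a (p + 1) \<and> \<not> b (p + 1)" "\<not> a (p + 4) \<and> \<not> b (p + 4)"
      using ab half(2) adj[of p] adj'[of p] by blast+
    then have 1: "f (p + 1) = 0" "f (p + 4) = 0"
      by (auto intro: f_0)
    have b: "\<not> b (p + 2)" "\<not> b (p + 3)" using ab dist[of p] dist'[of p] by blast+
    have 2: "f p \<le> 2" "f (p + 2) \<le> 2" "f (p + 3) \<le> 2"
      unfolding f_def by (simp_all add: impl(2) b ab)
    have "\<not> a (p + 2) \<or> \<not> a (p + 3)" using adj[of "p + 2"] by (auto simp: add.commute)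
    then have "f (p + 2) = 0 \<or> f (p + 3) = 0"
      using b f_0[of "p + 2"] f_0[of "p + 3"] by auto
    with 1 2 show ?thesis unfolding total[OF half(1)] by linarith
  next
    case rest
    have le: "f p \<le> 1" if "p \<in> {0, 1, 2, 3, 4}" for p
      using rest[OF that] impl(2)[of p] by (auto simp: f_def)
    \<comment> \<open>Without \<open>d\<close> no phase has both \<open>a\<close> and
      \<open>b\<close>. Neighbouring occupied phases must be \<open>a\<close> followed by
      \<open>b\<close>, so three consecutive phases cannot all be occupied.\<close>
    have "\<not> ((a 0 \<or> b 0) \<and> (a 1 \<or> b 1) \<and> (a 2 \<or> b 2))"
      using adj[of 0] adj[of 1] impl(2)[of 1] rest[of 1] by auto
    then have "f 0 = 0 \<or> f 1 = 0 \<or> f 2 = 0"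
      using rest by (auto simp: f_def)
    with le[of 0] le[of 1] le[of 2] le[of 3] le[of 4] show ?thesis by auto
  qed
  then show ?thesis by (simp only: defs f_def)
qed

lemma sum_card_phases:
  assumes "finite V" "E \<subseteq> V \<times> V"
  shows "(\<Sum>p\<in>{0, 1, 2, 3, 4}. card {w. phase w p 1 4} + card {w. phase w p 3 1}
      + card {w. phase w p 1 2} + card {w. phase w p 1 1}) \<le> 4 * card V"
proof -
  have eq: "card {w. phase w p s 1} = (\<Sum>w\<in>V. of_bool (phase w p s 1))"
    "card {w. phase w p 1 t} = (\<Sum>w\<in>V. of_bool (phase w p 1 t))" for p s t
  proof -
    have "{w. phase w p s 1} = {w \<in> V. phase w p s 1}" "{w. phase w p 1 t} = {w \<in> V. phase w p 1 t}"
      using assms(2) by (auto simp: walk_phase_def)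
    then show "card {w. phase w p s 1} = (\<Sum>w\<in>V. of_bool (phase w p s 1))"
      "card {w. phase w p 1 t} = (\<Sum>w\<in>V. of_bool (phase w p 1 t))"
      using assms(1) by (simp_all add: sum.If_cases of_bool_def Int_def conj_commute)
  qed
  have "(\<Sum>p\<in>{0, 1, 2, 3, 4}. card {w. phase w p 1 4} + card {w. phase w p 3 1}
      + card {w. phase w p 1 2} + card {w. phase w p 1 1})
    = (\<Sum>w\<in>V. \<Sum>p\<in>{0, 1, 2, 3, 4}. of_bool (phase w p 1 4) + of_bool (phase w p 3 1)
      + of_bool (phase w p 1 2) + of_bool (phase w p 1 1))"
    unfolding eq sum.distrib[symmetric] by (rule sum.swap)
  also have "\<dots> \<le> (\<Sum>w\<in>V. 4)" by (intro sum_mono phase_count)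
  finally show ?thesis by simp
qed

end

section \<open>Counting closed 5-walks by sampling\<close>

text \<open>AM-GM in the form of a tangent plane at \<open>x = y = z = t = 1\<close>: apply
  \<open>ln u \<le> u - 1\<close> to the four numbers and to the reciprocal of their
  product.\<close>

lemma inverse_prod_4_ge:
  fixes x y z t :: real
  assumes "x > 0" "y > 0" "z > 0" "t > 0"
  shows "1 / (x * y * z * t) \<ge> 5 - (x + y + z + t)"
proof -
  have "ln (1 / (x * y * z * t)) \<le> 1 / (x * y * z * t) - 1"
    using assms by (intro ln_le_minus_one) simp
  moreover have "ln (1 / (x * y * z * t)) = - (ln x + ln y + ln z + ln t)"
    using assms by (simp add: ln_div ln_mult)
  moreover have "ln x \<le> x - 1" "ln y \<le> y - 1" "ln z \<le> z - 1" "ln t \<le> t - 1"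
    using assms by (auto intro: ln_le_minus_one)
  ultimately show ?thesis by linarith
qed

context cycle_in_oriented
begin

lemma sum_inverse_phases:
  assumes "finite V" "E \<subseteq> V \<times> V"
  shows "(\<Sum>i\<in>{0, 1, 2, 3, 4}. 1 / (real (card {w. phase w (i + 1) 1 4}) * real (card {w. phase w (i + 4) 3 1})
      * real (card {w. phase w (i + 2) 1 2}) * real (card {w. phase w (i + 3) 1 1})))
    \<ge> 5 * (5 / real (card V)) ^ 4"
proof -
  define m where "m = real (card V)"
  define N where "N p s t = card {w. phase w p s t}" for p s t
  \<comment> \<open>In a blow-up of the 5-cycle with equal classes the sizes used below are all
    \<open>m / 5\<close>; this scaling turns them into 1, where \<open>inverse_prod_4_ge\<close> is
    tight.\<close>
  define z where "z p s t = 5 * real (N p s t) / m" for p s t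
  have "v 0 \<in> V" using arc[of 0] assms(2) by auto
  then have m: "m > 0" unfolding m_def using assms(1) by (auto simp: card_gt_0_iff)
  have "N p s t > 0" if "s = 1 \<or> t = 1" for p s t
  proof -
    have "{w. phase w p s t} \<subseteq> V" using assms(2) that by (auto simp: walk_phase_def)
    moreover have "phase (v p) p s t"
      using walk[of "p - int s" s] walk[of p t] by (simp add: walk_phase_def)
    ultimately show ?thesis
      unfolding N_def using finite_subset[OF _ assms(1)] by (auto simp: card_gt_0_iff)
  qed
  then have z_pos: "z p s t > 0" if "s = 1 \<or> t = 1" for p s t
    using that m by (simp add: z_def)
  have per: "z (p + 5) s t = z p s t" for p s t
    by (simp only: z_def N_def walk_phase_periodic)
  have "(\<Sum>p\<in>{0, 1, 2, 3, 4}. real (N p 1 4 + N p 3 1 + N p 1 2 + N p 1 1)) \<le> 4 * m"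
    using sum_card_phases[OF assms] unfolding N_def m_def of_nat_sum[symmetric] by linarith
  then have "(5 / m) * (\<Sum>p\<in>{0, 1, 2, 3, 4}. real (N p 1 4 + N p 3 1 + N p 1 2 + N p 1 1)) \<le> (5 / m) * (4 * m)"
    using m by (intro mult_left_mono) auto
  also have "(5 / m) * (\<Sum>p\<in>{0, 1, 2, 3, 4}. real (N p 1 4 + N p 3 1 + N p 1 2 + N p 1 1))
      = (\<Sum>p\<in>{0, 1, 2, 3, 4}. z p 1 4 + z p 3 1 + z p 1 2 + z p 1 1)"
    unfolding sum_distrib_left z_def by (intro sum.cong) (auto simp: algebra_simps add_divide_distrib)
  finally have tot: "(\<Sum>p\<in>{0, 1, 2, 3, 4}. z p 1 4 + z p 3 1 + z p 1 2 + z p 1 1) \<le> 20"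
    using m by simp
  have "(\<Sum>i\<in>{0, 1, 2, 3, 4}. 1 / (z (i + 1) 1 4 * z (i + 4) 3 1 * z (i + 2) 1 2 * z (i + 3) 1 1))
      \<ge> (\<Sum>i\<in>{0, 1, 2, 3, 4}. 5 - (z (i + 1) 1 4 + z (i + 4) 3 1 + z (i + 2) 1 2 + z (i + 3) 1 1))"
    by (intro sum_mono inverse_prod_4_ge z_pos) auto
  \<comment> \<open>Adding 1, 4, 2 or 3 to \<open>i\<close> only permutes the residues modulo 5, so
    each kind is summed once over all phases.\<close>
  moreover have "(\<Sum>i\<in>{0, 1, 2, 3, 4}. 5 - (z (i + 1) 1 4 + z (i + 4) 3 1 + z (i + 2) 1 2 + z (i + 3) 1 1))
      = 25 - (\<Sum>p\<in>{0, 1, 2, 3, 4}. z p 1 4 + z p 3 1 + z p 1 2 + z p 1 1)"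
    using per[of 0] per[of 1] per[of 2] per[of 3] by simp
  ultimately have "5 \<le> (\<Sum>i\<in>{0, 1, 2, 3, 4}. 1 / (z (i + 1) 1 4 * z (i + 4) 3 1 * z (i + 2) 1 2 * z (i + 3) 1 1))"
    using tot by linarith
  also have "\<dots> = (\<Sum>i\<in>{0, 1, 2, 3, 4}. 1 / (real (N (i + 1) 1 4) * real (N (i + 4) 3 1)
     * real (N (i + 2) 1 2) * real (N (i + 3) 1 1))) * (m / 5) ^ 4"
    unfolding sum_distrib_right z_def by (intro sum.cong) (auto simp: power4_eq_xxxx)
  finally have "5 \<le> (\<Sum>i\<in>{0, 1, 2, 3, 4}. 1 / (real (N (i + 1) 1 4) * real (N (i + 4) 3 1)
     * real (N (i + 2) 1 2) * real (N (i + 3) 1 1))) * (m / 5) ^ 4" .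
  then have "5 / (m / 5) ^ 4 \<le> (\<Sum>i\<in>{0, 1, 2, 3, 4}. 1 / (real (N (i + 1) 1 4) * real (N (i + 4) 3 1)
     * real (N (i + 2) 1 2) * real (N (i + 3) 1 1)))"
    using m by (subst pos_divide_le_eq) auto
  then show ?thesis unfolding N_def m_def by (simp only: power_divide divide_divide_eq_right times_divide_eq_right)
qed

end

definition five_cycles :: "'a rel \<Rightarrow> ('a \<times> 'a \<times> 'a \<times> 'a \<times> 'a) set" where
  "five_cycles E = {(a, b, c, d, e). (a, b) \<in> E \<and> (b, c) \<in> E \<and> (c, d) \<in> E \<and> (d, e) \<in> E \<and> (e, a) \<in> E}"

text \<open>The probability, given \<open>a\<close>, that sampling \<open>b, e, c, d\<close> in this order, each one uniformly from a
  set of candidates determined by the earlier ones, yields this 5-cycle. With this order the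
  candidate sets are of the kinds \<open>(1, 4)\<close>, \<open>(3, 1)\<close>, \<open>(1, 2)\<close>, \<open>(1, 1)\<close> counted in \<open>phase_count\<close>.\<close>

definition cycle_weight :: "'a rel \<Rightarrow> 'a \<times> 'a \<times> 'a \<times> 'a \<times> 'a \<Rightarrow> real" where
  "cycle_weight E = (\<lambda>(a, b, c, d, e). 1 / (real (card {w. (a, w) \<in> E \<and> (w, a) \<in> E ^^ 4})
     * real (card {w. (b, w) \<in> E ^^ 3 \<and> (w, a) \<in> E})
     * real (card {w. (b, w) \<in> E \<and> (w, e) \<in> E ^^ 2})
     * real (card {w. (c, w) \<in> E \<and> (w, e) \<in> E})))"

text \<open>One step of the sampling: an average is at most the maximum. If
  \<open>card A = 0\<close>, the division by zero makes the sum 0, and \<open>c \<ge> 0\<close> is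
  what counts.\<close>

lemma sum_div_card_le:
  fixes h :: "'a \<Rightarrow> real"
  assumes "\<And>x. x \<in> A \<Longrightarrow> h x \<le> c" "c \<ge> 0"
  shows "(\<Sum>x\<in>A. h x / real (card A)) \<le> c"
proof (cases "card A = 0")
  case False
  have "(\<Sum>x\<in>A. h x / real (card A)) \<le> real (card A) * (c / real (card A))"
    using assms(1) by (intro sum_bounded_above divide_right_mono) auto
  then show ?thesis using False by simp
qed (use assms in \<open>auto simp: card_eq_0_iff\<close>)

text \<open>For a fixed start \<open>a\<close> the weights are probabilities of disjoint outcomes,
  so they add up to at most 1.\<close>

lemma sum_cycle_weight_le:
  assumes "finite V" "E \<subseteq> V \<times> V"
  shows "(\<Sum>D\<in>five_cycles E. cycle_weight E D) \<le> real (card V)"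
proof -
  define A1 where "A1 a = {w. (a, w) \<in> E \<and> (w, a) \<in> E ^^ 4}" for a
  define A2 where "A2 a b = {w. (b, w) \<in> E ^^ 3 \<and> (w, a) \<in> E}" for a b
  define A3 where "A3 b e = {w. (b, w) \<in> E \<and> (w, e) \<in> E ^^ 2}" for b e
  define A4 where "A4 c e = {w. (c, w) \<in> E \<and> (w, e) \<in> E}" for c e
  have fin: "finite (A1 a)" "finite (A2 a b)" "finite (A3 b e)" "finite (A4 c e)" for a b c e
    using assms by (auto simp: A1_def A2_def A3_def A4_def intro!: finite_subset[OF _ assms(1)])
  \<comment> \<open>All outcomes of the sampling, nested in the order in which the vertices are
    drawn. Each 5-cycle occurs here, because its own vertices are candidates at every stage.\<close>
  define S where "S = Sigma V (\<lambda>a. Sigma (A1 a) (\<lambda>b. Sigma (A2 a b) (\<lambda>e. Sigma (A3 b e) (\<lambda>c. A4 c e))))"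
  define r where "r = (\<lambda>(a, b, c, d, e). (a, b, e, c, d) :: 'a \<times> 'a \<times> 'a \<times> 'a \<times> 'a)"
  define g where "g = (\<lambda>(a, b, e, c, d :: 'a). 1 / real (card (A4 c e)) / real (card (A3 b e))
    / real (card (A2 a b)) / real (card (A1 a)))"
  have "r ` five_cycles E \<subseteq> S"
    using assms(2)
    by (force simp: r_def five_cycles_def S_def A1_def A2_def A3_def A4_def numeral_eq_Suc
        intro: relcompI)
  moreover have "finite S" unfolding S_def using assms(1) fin by (intro finite_SigmaI) auto
  moreover have "inj_on r (five_cycles E)" by (auto simp: r_def inj_on_def)
  moreover have "cycle_weight E D = g (r D)" for D
    by (cases D) (simp add: cycle_weight_def r_def g_def A1_def A2_def A3_def A4_def ac_simps)
  ultimately have "(\<Sum>D\<in>five_cycles E. cycle_weight E D) \<le> sum g S"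
    using sum_mono2[of S "r ` five_cycles E" g] by (auto simp: sum.reindex g_def)
  also have "\<dots> = (\<Sum>a\<in>V. \<Sum>b\<in>A1 a. (\<Sum>e\<in>A2 a b. (\<Sum>c\<in>A3 b e. (\<Sum>d\<in>A4 c e. 1 / real (card (A4 c e)))
     / real (card (A3 b e))) / real (card (A2 a b))) / real (card (A1 a)))"
    unfolding S_def g_def using assms(1) fin
    by (simp add: sum.Sigma[symmetric] sum_divide_distrib del: sum_constant)
  also have "\<dots> \<le> (\<Sum>a\<in>V. 1)"
    by (intro sum_mono sum_div_card_le) auto
  finally show ?thesis by simp
qed

definition rotate5 :: "'a \<times> 'a \<times> 'a \<times> 'a \<times> 'a \<Rightarrow> 'a \<times> 'a \<times> 'a \<times> 'a \<times> 'a" where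
  "rotate5 = (\<lambda>(a, b, c, d, e). (b, c, d, e, a))"

lemma sum_five_cycles_rotate: "(\<Sum>D\<in>five_cycles E. h (rotate5 D)) = sum h (five_cycles E)"
  by (rule sum.reindex_bij_witness[where i = "\<lambda>(b, c, d, e, a). (a, b, c, d, e)" and j = rotate5])
    (auto simp: five_cycles_def rotate5_def)

context oriented_no_closed_walk
begin

lemma cycle_weight_rotations:
  assumes "finite V" "E \<subseteq> V \<times> V" and D: "D \<in> five_cycles E"
  shows "5 * (5 / real (card V)) ^ 4 \<le> cycle_weight E D + cycle_weight E (rotate5 D)
    + cycle_weight E (rotate5 (rotate5 D)) + cycle_weight E (rotate5 (rotate5 (rotate5 D)))
    + cycle_weight E (rotate5 (rotate5 (rotate5 (rotate5 D))))"
proof -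
  obtain a b c d e where abcde: "D = (a, b, c, d, e)" by (cases D)
  define v where "v i = [a, b, c, d, e] ! nat (i mod 5)" for i
  \<comment> \<open>Indices up to 9 occur: phase \<open>i + 1\<close> with \<open>t = 4\<close>
    looks ahead to \<open>v (i + 5)\<close>, and \<open>i\<close> runs up to 4.\<close>
  have v: "v 0 = a" "v 1 = b" "v 2 = c" "v 3 = d" "v 4 = e" "v 5 = a" "v 6 = b" "v 7 = c" "v 8 = d" "v 9 = e"
    by (simp_all add: v_def)
  interpret cycle_in_oriented E v l
  proof unfold_locales
    fix i :: int
    show "v (i + 5) = v i" by (simp add: v_def)
    have "i mod 5 \<in> {0, 1, 2, 3, 4}" by auto
    moreover have "(i + 1) mod 5 = (i mod 5 + 1) mod 5" by (simp add: mod_simps)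
    ultimately show "(v i, v (i + 1)) \<in> E"
      using D by (auto simp: v_def abcde five_cycles_def)
  qed
  have "5 * (5 / real (card V)) ^ 4 \<le> (\<Sum>i\<in>{0, 1, 2, 3, 4}. 1 / (real (card {w. phase w (i + 1) 1 4}) * real (card {w. phase w (i + 4) 3 1})
      * real (card {w. phase w (i + 2) 1 2}) * real (card {w. phase w (i + 3) 1 1})))"
    by (rule sum_inverse_phases[OF assms(1,2)])
  \<comment> \<open>When \<open>v i\<close> is the start, the remaining vertices are drawn at phases
    \<open>i + 1\<close>, \<open>i + 4\<close>, \<open>i + 2\<close>, \<open>i + 3\<close>, so
    summand \<open>i\<close> is the weight of the \<open>i\<close>-th rotation.\<close>
  also have "\<dots> = cycle_weight E D + cycle_weight E (rotate5 D)
    + cycle_weight E (rotate5 (rotate5 D)) + cycle_weight E (rotate5 (rotate5 (rotate5 D)))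
    + cycle_weight E (rotate5 (rotate5 (rotate5 (rotate5 D))))"
    by (simp add: walk_phase_def v abcde cycle_weight_def rotate5_def)
  finally show ?thesis .
qed

text \<open>Over all tuples, the five rotated weights have equal sums, each at most
  \<open>card V\<close>, while every tuple contributes at least \<open>5 * (5 / card V) ^ 4\<close>.
  A cycle appears as five tuples, so the bound is \<open>5 * (card V / 5) ^ 5\<close>.\<close>

theorem card_five_cycles_le:
  assumes "finite V" "E \<subseteq> V \<times> V"
  shows "real (card (five_cycles E)) \<le> real (card V) ^ 5 / 625"
proof (cases "card V = 0")
  case True
  with assms have "E = {}" by auto
  then have "five_cycles E = {}" by (auto simp: five_cycles_def)
  then show ?thesis by simp
next
  case False
  define m where "m = real (card V)"
  have m: "m > 0" using False by (simp add: m_def)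
  have "real (card (five_cycles E)) * (5 * (5 / m) ^ 4) = (\<Sum>D\<in>five_cycles E. 5 * (5 / m) ^ 4)"
    by simp
  also have "\<dots> \<le> (\<Sum>D\<in>five_cycles E. cycle_weight E D + cycle_weight E (rotate5 D)
    + cycle_weight E (rotate5 (rotate5 D)) + cycle_weight E (rotate5 (rotate5 (rotate5 D)))
    + cycle_weight E (rotate5 (rotate5 (rotate5 (rotate5 D)))))"
    unfolding m_def by (intro sum_mono cycle_weight_rotations assms)
  also have "\<dots> = 5 * sum (cycle_weight E) (five_cycles E)"
    unfolding sum.distrib
      sum_five_cycles_rotate[where h = "\<lambda>D. cycle_weight E (rotate5 (rotate5 (rotate5 D)))"]
      sum_five_cycles_rotate[where h = "\<lambda>D. cycle_weight E (rotate5 (rotate5 D))"]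
      sum_five_cycles_rotate[where h = "\<lambda>D. cycle_weight E (rotate5 D)"]
      sum_five_cycles_rotate[where h = "cycle_weight E"] by simp
  also have "\<dots> \<le> 5 * m"
    unfolding m_def using sum_cycle_weight_le[OF assms] by simp
  finally show ?thesis using m unfolding m_def[symmetric]
    by (simp add: field_simps power_divide eval_nat_numeral)
qed

end

section \<open>Random pullbacks\<close>

definition closed_walks :: "'a set \<Rightarrow> 'a rel \<Rightarrow> nat \<Rightarrow> (nat \<Rightarrow> 'a) set" where
  "closed_walks V E k = {x \<in> {..<k} \<rightarrow>\<^sub>E V. \<forall>i<k. (x i, x (Suc i mod k)) \<in> E}"

text \<open>The pattern \<open>q\<close> prescribes which positions of the closed walk share a
  vertex; points of \<open>I\<close> that \<open>q\<close> does not use are free.\<close>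

definition pattern_maps :: "'a set \<Rightarrow> 'a rel \<Rightarrow> nat \<Rightarrow> nat set \<Rightarrow> (nat \<Rightarrow> nat) \<Rightarrow> (nat \<Rightarrow> 'a) set" where
  "pattern_maps V E k I q = {\<phi> \<in> I \<rightarrow>\<^sub>E V. \<forall>i<k. (\<phi> (q i), \<phi> (q (Suc i mod k))) \<in> E}"

lemma finite_closed_walks: "finite V \<Longrightarrow> finite (closed_walks V E k)"
  by (simp add: closed_walks_def finite_PiE)

lemma finite_pattern_maps: "finite V \<Longrightarrow> finite I \<Longrightarrow> finite (pattern_maps V E k I q)"
  by (simp add: pattern_maps_def finite_PiE)

text \<open>Without coincidences a map is a closed walk together with arbitrary values at the
  \<open>card I - k\<close> free points; \<open>F\<close> and \<open>G\<close> separate and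
  recombine the two.\<close>

lemma card_pattern_maps_inj:
  assumes "finite I" "inj_on q {..<k}" "q ` {..<k} \<subseteq> I"
  shows "card (pattern_maps V E k I q) = card (closed_walks V E k) * card V ^ (card I - k)"
proof -
  define J where "J = I - q ` {..<k}"
  define g where "g = the_inv_into {..<k} q"
  have gq: "g (q i) = i" if "i < k" for i
    unfolding g_def using that assms(2) by (intro the_inv_into_f_f) auto
  define F where "F \<phi> = (restrict (\<phi> \<circ> q) {..<k}, restrict \<phi> J)" for \<phi> :: "nat \<Rightarrow> 'a"
  define G where "G = (\<lambda>(x, \<psi>). \<lambda>j\<in>I. if j \<in> J then \<psi> j else x (g j) :: 'a)"
  have mod: "Suc i mod k < k" if "i < k" for i
    using that by (intro mod_less_divisor) auto
  have qI: "q i \<in> I" "q i \<notin> J" if "i < k" for i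
    using that assms(3) by (auto simp: J_def)
  have "bij_betw F (pattern_maps V E k I q) (closed_walks V E k \<times> (J \<rightarrow>\<^sub>E V))"
  proof (rule bij_betw_byWitness[where f' = G])
    show "\<forall>\<phi>\<in>pattern_maps V E k I q. G (F \<phi>) = \<phi>"
    proof
      fix \<phi> assume "\<phi> \<in> pattern_maps V E k I q"
      then have ext: "\<phi> \<in> extensional I" by (auto simp: pattern_maps_def PiE_def)
      show "G (F \<phi>) = \<phi>"
      proof
        fix j
        show "G (F \<phi>) j = \<phi> j"
        proof (cases "j \<in> q ` {..<k}")
          case True
          then show ?thesis using qI gq by (auto simp: G_def F_def)
        next
          case False
          then show ?thesis using ext by (auto simp: G_def F_def J_def extensional_def)
        qed
      qed
    qed
    show "\<forall>z\<in>closed_walks V E k \<times> (J \<rightarrow>\<^sub>E V). F (G z) = z"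
    proof safe
      fix x \<psi> assume x: "x \<in> closed_walks V E k" and \<psi>: "\<psi> \<in> J \<rightarrow>\<^sub>E V"
      have "restrict (G (x, \<psi>) \<circ> q) {..<k} = x"
        using x qI gq by (intro ext) (auto simp: G_def closed_walks_def PiE_def extensional_def)
      moreover have "restrict (G (x, \<psi>)) J = \<psi>"
        using \<psi> by (intro ext) (auto simp: G_def J_def PiE_def extensional_def)
      ultimately show "F (G (x, \<psi>)) = (x, \<psi>)" by (simp add: F_def)
    qed
    show "F ` pattern_maps V E k I q \<subseteq> closed_walks V E k \<times> (J \<rightarrow>\<^sub>E V)"
    proof (rule image_subsetI)
      fix \<phi> assume \<phi>: "\<phi> \<in> pattern_maps V E k I q"
      then have "restrict (\<phi> \<circ> q) {..<k} \<in> closed_walks V E k"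
        using qI mod by (auto simp: pattern_maps_def closed_walks_def)
      moreover have "restrict \<phi> J \<in> J \<rightarrow>\<^sub>E V"
        using \<phi> by (auto simp: pattern_maps_def J_def)
      ultimately show "F \<phi> \<in> closed_walks V E k \<times> (J \<rightarrow>\<^sub>E V)" by (simp add: F_def)
    qed
    show "G ` (closed_walks V E k \<times> (J \<rightarrow>\<^sub>E V)) \<subseteq> pattern_maps V E k I q"
    proof safe
      fix x \<psi> assume x: "x \<in> closed_walks V E k" and \<psi>: "\<psi> \<in> J \<rightarrow>\<^sub>E V"
      have "G (x, \<psi>) (q i) = x i" if "i < k" for i
        using that qI gq by (simp add: G_def)
      then have "\<forall>i<k. (G (x, \<psi>) (q i), G (x, \<psi>) (q (Suc i mod k))) \<in> E"
        using x mod by (simp add: closed_walks_def)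
      moreover have "G (x, \<psi>) j \<in> V" if jI: "j \<in> I" for j
      proof (cases "j \<in> J")
        case False
        then obtain i where "i < k" "j = q i" using jI by (auto simp: J_def)
        then show ?thesis using x qI gq by (auto simp: G_def closed_walks_def)
      qed (use \<psi> that in \<open>auto simp: G_def\<close>)
      ultimately show "G (x, \<psi>) \<in> pattern_maps V E k I q"
        by (auto simp: pattern_maps_def PiE_iff extensional_def G_def)
    qed
  qed
  then have "card (pattern_maps V E k I q) = card (closed_walks V E k) * card (J \<rightarrow>\<^sub>E V)"
    using bij_betw_same_card card_cartesian_product by metis
  moreover have "card J = card I - k"
    using assms card_image[OF assms(2)] by (simp add: J_def card_Diff_subset finite_subset)
  ultimately show ?thesis using assms(1) by (simp add: card_funcsetE J_def)
qed

text \<open>Cauchy--Schwarz on the coordinate \<open>q j\<close>: two independent values of it can be used at the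
  position \<open>j\<close> and at all other positions, respectively.\<close>

lemma card_pattern_maps_split:
  assumes "finite V" "finite I" "\<And>w. (w, w) \<notin> E"
    and q: "q ` {..<k} \<subseteq> I" and j: "j < k" and b: "b \<notin> I"
  shows "card (pattern_maps V E k I q) ^ 2
    \<le> card V ^ (card I - 1) * card (pattern_maps V E k (insert b I) (q(j := b)))"
proof -
  define a where "a = q j"
  have a: "a \<in> I" using q j by (auto simp: a_def)
  have ab: "a \<noteq> b" using a b by auto
  have qI: "q i \<in> I" if "i < k" for i using that q by auto
  have mod: "Suc i mod k < k" if "i < k" for i
    using that by (intro mod_less_divisor) auto
  define P where "P = pattern_maps V E k I q"
  define \<Psi> where "\<Psi> = (I - {a}) \<rightarrow>\<^sub>E V"
  \<comment> \<open>The fibre over \<open>\<psi>\<close>: admissible values at \<open>a\<close> once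
    all other coordinates are fixed. Pairs from one fibre are what Cauchy--Schwarz counts.\<close>
  define X where "X \<psi> = {x. \<psi>(a := x) \<in> P}" for \<psi>
  have fin: "finite \<Psi>" "finite P"
    using assms by (simp_all add: \<Psi>_def finite_PiE P_def finite_pattern_maps)
  have XV: "X \<psi> \<subseteq> V" for \<psi>
    using a by (force simp: X_def P_def pattern_maps_def PiE_iff)
  then have finX: "finite (X \<psi>)" for \<psi> using assms(1) finite_subset by blast
  have "bij_betw (\<lambda>(\<psi>, x). \<psi>(a := x)) (Sigma \<Psi> X) P"
  proof (rule bij_betw_byWitness[where f' = "\<lambda>\<phi>. (restrict \<phi> (I - {a}), \<phi> a)"])
    show "\<forall>z\<in>Sigma \<Psi> X. (restrict (case z of (\<psi>, x) \<Rightarrow> \<psi>(a := x)) (I - {a}), (case z of (\<psi>, x) \<Rightarrow> \<psi>(a := x)) a) = z"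
      by (auto simp: \<Psi>_def PiE_def extensional_def fun_eq_iff)
    have eq: "(restrict \<phi> (I - {a}))(a := \<phi> a) = \<phi>" if "\<phi> \<in> P" for \<phi>
      using that a by (auto simp: P_def pattern_maps_def PiE_def extensional_def fun_eq_iff)
    then show "\<forall>\<phi>\<in>P. (case (restrict \<phi> (I - {a}), \<phi> a) of (\<psi>, x) \<Rightarrow> \<psi>(a := x)) = \<phi>" by simp
    show "(\<lambda>(\<psi>, x). \<psi>(a := x)) ` Sigma \<Psi> X \<subseteq> P" by (auto simp: X_def)
    show "(\<lambda>\<phi>. (restrict \<phi> (I - {a}), \<phi> a)) ` P \<subseteq> Sigma \<Psi> X"
    proof (rule image_subsetI)
      fix \<phi> assume \<phi>: "\<phi> \<in> P"
      then have "restrict \<phi> (I - {a}) \<in> \<Psi>" by (auto simp: \<Psi>_def P_def pattern_maps_def)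
      moreover have "\<phi> a \<in> X (restrict \<phi> (I - {a}))" using \<phi> eq[OF \<phi>] unfolding X_def by (simp only: mem_Collect_eq)
      ultimately show "(restrict \<phi> (I - {a}), \<phi> a) \<in> Sigma \<Psi> X" by blast
    qed
  qed
  then have "card P = (\<Sum>\<psi>\<in>\<Psi>. card (X \<psi>))"
    using bij_betw_same_card fin finX by (metis card_SigmaI)
  then have "real (card P) = (\<Sum>\<psi>\<in>\<Psi>. real (card (X \<psi>)))" by simp
  then have "real (card P) ^ 2 \<le> (\<Sum>\<psi>\<in>\<Psi>. real (card (X \<psi>)) ^ 2) * real (card \<Psi>)"
    using sum_squared_le_sum_of_squares[of "\<lambda>\<psi>. real (card (X \<psi>))" \<Psi>] by simp
  also have "\<dots> = real ((\<Sum>\<psi>\<in>\<Psi>. card (X \<psi>) ^ 2) * card \<Psi>)" by simp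
  finally have 1: "card P ^ 2 \<le> (\<Sum>\<psi>\<in>\<Psi>. card (X \<psi>) ^ 2) * card \<Psi>"
    by (metis of_nat_le_iff of_nat_power)
  define h where "h = (\<lambda>(\<psi>, x, y). \<psi>(a := x, b := y) :: nat \<Rightarrow> 'a)"
  have "inj_on h (Sigma \<Psi> (\<lambda>\<psi>. X \<psi> \<times> X \<psi>))"
  proof (rule inj_on_inverseI[where g = "\<lambda>\<phi>. (restrict \<phi> (I - {a}), \<phi> a, \<phi> b)"])
    fix z assume "z \<in> Sigma \<Psi> (\<lambda>\<psi>. X \<psi> \<times> X \<psi>)"
    then show "(restrict (h z) (I - {a}), h z a, h z b) = z"
      using ab b by (auto simp: h_def \<Psi>_def PiE_def extensional_def fun_eq_iff)
  qed
  moreover have "h ` Sigma \<Psi> (\<lambda>\<psi>. X \<psi> \<times> X \<psi>) \<subseteq> pattern_maps V E k (insert b I) (q(j := b))"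
  proof safe
    fix \<psi> x y assume \<psi>: "\<psi> \<in> \<Psi>" and x: "x \<in> X \<psi>" and y: "y \<in> X \<psi>"
    define \<phi> where "\<phi> = h (\<psi>, x, y)"
    have \<phi>: "\<phi> i = (if i = b then y else (\<psi>(a := x)) i)" for i
      by (simp add: \<phi>_def h_def)
    have "(\<phi> ((q(j := b)) i), \<phi> ((q(j := b)) (Suc i mod k))) \<in> E" if i: "i < k" for i
    proof -
      have X: "((\<psi>(a := x)) (q i), (\<psi>(a := x)) (q (Suc i mod k))) \<in> E"
        "((\<psi>(a := y)) (q i), (\<psi>(a := y)) (q (Suc i mod k))) \<in> E"
        using x y i by (auto simp: X_def P_def pattern_maps_def)
      \<comment> \<open>As there are no loops, at most one end of an arc uses the point
        \<open>a\<close>. Hence an arc at position \<open>j\<close> involves \<open>y\<close> but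
        not \<open>x\<close>, and every other arc is one for \<open>\<psi>(a := x)\<close>.\<close>
      then have ne: "q i \<noteq> q (Suc i mod k)" using assms(3) by metis
      have nb: "q i \<noteq> b" "q (Suc i mod k) \<noteq> b" using qI[OF i] qI[OF mod[OF i]] b by auto
      consider "i = j" "Suc i mod k \<noteq> j" | "i \<noteq> j" "Suc i mod k = j" | "i \<noteq> j" "Suc i mod k \<noteq> j"
        using ne by metis
      then show ?thesis
      proof cases
        case 1
        then show ?thesis using X(2) ne nb by (auto simp: \<phi> a_def)
      next
        case 2
        then show ?thesis using X(2) ne nb by (auto simp: \<phi> a_def)
      next
        case 3
        then show ?thesis using X(1) nb by (auto simp: \<phi>)
      qed
    qed
    moreover have "\<phi> \<in> insert b I \<rightarrow>\<^sub>E V"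
      using a \<psi> x y XV by (auto simp: PiE_iff \<phi> \<Psi>_def extensional_def)
    ultimately show "h (\<psi>, x, y) \<in> pattern_maps V E k (insert b I) (q(j := b))"
      by (simp add: pattern_maps_def \<phi>_def)
  qed
  ultimately have "card (Sigma \<Psi> (\<lambda>\<psi>. X \<psi> \<times> X \<psi>)) \<le> card (pattern_maps V E k (insert b I) (q(j := b)))"
    using assms(1,2) by (intro card_inj_on_le[where f = h] finite_pattern_maps) auto
  moreover have "card (Sigma \<Psi> (\<lambda>\<psi>. X \<psi> \<times> X \<psi>)) = (\<Sum>\<psi>\<in>\<Psi>. card (X \<psi>) ^ 2)"
    using fin finX by (simp add: card_cartesian_product power2_eq_square)
  ultimately have 2: "(\<Sum>\<psi>\<in>\<Psi>. card (X \<psi>) ^ 2) \<le> card (pattern_maps V E k (insert b I) (q(j := b)))"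
    by simp
  have "card \<Psi> = card V ^ (card I - 1)"
    using a assms(2) by (simp add: \<Psi>_def card_funcsetE)
  with order.trans[OF 1 mult_le_mono1[OF 2]] show ?thesis by (simp add: P_def mult.commute)
qed

text \<open>A split moves one of two positions sharing a point to a fresh point; the square of the
  old density is at most the new one. One split per missing value of \<open>q\<close> leads to an
  injective pattern, whose density is that of the closed walks.\<close>

lemma pattern_density_le:
  fixes I :: "nat set"
  assumes "finite V" "V \<noteq> {}" "\<And>w. (w, w) \<notin> E" "finite I" "q ` {..<k} \<subseteq> I"
  shows "(card (pattern_maps V E k I q) / real (card V) ^ card I) ^ 2 ^ (k - card (q ` {..<k}))
    \<le> card (closed_walks V E k) / real (card V) ^ k"
  using assms(4,5)
proof (induction "k - card (q ` {..<k})" arbitrary: I q)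
  case 0
  have n: "card V > 0" using assms by (simp add: card_gt_0_iff)
  have "card (q ` {..<k}) \<le> k" using card_image_le[of "{..<k}" q] by simp
  with 0 have eq: "card (q ` {..<k}) = card {..<k}" by simp
  then have inj: "inj_on q {..<k}" by (intro eq_card_imp_inj_on) auto
  have "k \<le> card I" using card_mono[OF 0(2,3)] eq by simp
  then have "real (card V) ^ card I = real (card V) ^ (card I - k) * real (card V) ^ k"
    by (simp add: power_add[symmetric])
  then show ?case using n 0(1) unfolding card_pattern_maps_inj[OF 0(2) inj 0(3)]
    by simp
next
  case (Suc d)
  let ?n = "real (card V)"
  have n: "card V > 0" using assms by (simp add: card_gt_0_iff)
  have "\<not> inj_on q {..<k}" using Suc(2) card_image[of q "{..<k}"] by auto
  then obtain i j where ij: "i < k" "j < k" "i \<noteq> j" "q i = q j" by (auto simp: inj_on_def)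
  obtain b where b: "b \<notin> I" using ex_new_if_finite[OF infinite_UNIV_nat Suc(3)] by blast
  define q' where "q' = q(j := b)"
  \<comment> \<open>Position \<open>i\<close> still uses the old point \<open>q j\<close>, so
    nothing is lost from the range.\<close>
  have im: "q' ` {..<k} = insert b (q ` {..<k})"
  proof -
    have "q l \<in> q' ` {..<k}" if "l < k" for l
      using that ij by (cases "l = j") (auto simp: q'_def image_iff intro: bexI[of _ i] bexI[of _ l])
    moreover have "b \<in> q' ` {..<k}" using ij by (auto simp: q'_def image_iff)
    ultimately show ?thesis by (auto simp: q'_def)
  qed
  have "b \<notin> q ` {..<k}" using b Suc(4) by auto
  then have "card (q' ` {..<k}) = Suc (card (q ` {..<k}))" by (simp add: im)
  then have d: "d = k - card (q' ` {..<k})" using Suc(2) by simp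
  have IH: "(card (pattern_maps V E k (insert b I) q') / ?n ^ card (insert b I)) ^ 2 ^ d
      \<le> card (closed_walks V E k) / ?n ^ k"
    using Suc(1)[OF d, of "insert b I"] Suc(3,4) im unfolding d[symmetric] by auto
  have I: "card I > 0" using Suc(3,4) ij by (auto simp: card_gt_0_iff)
  have "real (card (pattern_maps V E k I q)) ^ 2
      \<le> ?n ^ (card I - 1) * card (pattern_maps V E k (insert b I) q')"
    using card_pattern_maps_split[OF assms(1) Suc(3) assms(3) Suc(4) ij(2) b]
    unfolding q'_def by (metis of_nat_le_iff of_nat_mult of_nat_power)
  then have "(card (pattern_maps V E k I q) / ?n ^ card I) ^ 2
      \<le> ?n ^ (card I - 1) * card (pattern_maps V E k (insert b I) q') / (?n ^ card I) ^ 2"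
    by (simp add: power_divide divide_right_mono)
  \<comment> \<open>The exponents agree:
    \<open>2 * card I = (card I - 1) + (card I + 1)\<close>.\<close>
  also have "(?n ^ card I) ^ 2 = ?n ^ (card I - 1) * ?n ^ card (insert b I)"
    using I b Suc(3) by (cases "card I") (simp_all add: power2_eq_square)
  finally have "(card (pattern_maps V E k I q) / ?n ^ card I) ^ 2
      \<le> card (pattern_maps V E k (insert b I) q') / ?n ^ card (insert b I)"
    using n by simp
  then have "((card (pattern_maps V E k I q) / ?n ^ card I) ^ 2) ^ 2 ^ d
      \<le> (card (pattern_maps V E k (insert b I) q') / ?n ^ card (insert b I)) ^ 2 ^ d"
    by (intro power_mono) auto
  also note IH
  finally show ?case unfolding Suc(2)[symmetric] by (simp add: power_mult[symmetric])
qed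

text \<open>Densities are at most 1, so raising the exponent to \<open>2 ^ k\<close> only lowers the
  left side. The exponent is then the same for all patterns.\<close>

lemma pattern_density_le_power:
  fixes I :: "nat set"
  assumes "finite V" "V \<noteq> {}" "\<And>w. (w, w) \<notin> E" "finite I" "q ` {..<k} \<subseteq> I"
  shows "(card (pattern_maps V E k I q) / real (card V) ^ card I) ^ 2 ^ k
    \<le> card (closed_walks V E k) / real (card V) ^ k"
proof -
  have n: "card V > 0" using assms by (simp add: card_gt_0_iff)
  have "card (pattern_maps V E k I q) \<le> card (I \<rightarrow>\<^sub>E V)"
    using assms by (intro card_mono) (auto simp: finite_PiE pattern_maps_def)
  then have "real (card (pattern_maps V E k I q)) \<le> real (card V) ^ card I"
    using assms(4) by (simp add: card_funcsetE flip: of_nat_power)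
  then have "card (pattern_maps V E k I q) / real (card V) ^ card I \<le> 1"
    using n by simp
  then have "(card (pattern_maps V E k I q) / real (card V) ^ card I) ^ 2 ^ k
     \<le> (card (pattern_maps V E k I q) / real (card V) ^ card I) ^ 2 ^ (k - card (q ` {..<k}))"
    by (intro power_decreasing power_increasing) auto
  also note pattern_density_le[OF assms]
  finally show ?thesis .
qed

text \<open>Choosing images one after another, at most \<open>card S\<close> values are already
  taken each time. The power is below the falling factorial but easier to handle in limits.\<close>

lemma card_inj_funcset_ge:
  assumes "finite S" "finite T"
  shows "(card T - card S) ^ card S \<le> card {f \<in> S \<rightarrow>\<^sub>E T. inj_on f S}"
  using assms(1)
proof (induction S rule: finite_induct)
  case (insert x S)
  define F where "F = {f \<in> S \<rightarrow>\<^sub>E T. inj_on f S}"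
  have finF: "finite F" using insert(1) assms(2) by (simp add: F_def finite_PiE)
  have "(card T - card (insert x S)) ^ card (insert x S) \<le> (card T - card S) ^ card (insert x S)"
    using insert(1,2) by (intro power_mono) auto
  also have "\<dots> = (card T - card S) ^ card S * (card T - card S)" using insert(1,2) by simp
  also have "\<dots> \<le> card F * (card T - card S)"
    unfolding F_def by (intro mult_le_mono1 insert.IH)
  also have "\<dots> = (\<Sum>f\<in>F. card T - card S)" by simp
  also have "\<dots> \<le> (\<Sum>f\<in>F. card (T - f ` S))"
  proof (rule sum_mono)
    fix f assume "f \<in> F"
    have "card T - card (f ` S) \<le> card (T - f ` S)" using insert(1) by (intro diff_card_le_card_Diff) auto
    then show "card T - card S \<le> card (T - f ` S)" using card_image_le[OF insert(1), of f] by linarith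
  qed
  also have "\<dots> = card (Sigma F (\<lambda>f. T - f ` S))" using finF assms(2) by simp
  also have "\<dots> \<le> card {f \<in> insert x S \<rightarrow>\<^sub>E T. inj_on f (insert x S)}"
  proof (rule card_inj_on_le)
    show "inj_on (\<lambda>(f, y). f(x := y)) (Sigma F (\<lambda>f. T - f ` S))"
      using insert(2)
      by (intro inj_on_inverseI[where g = "\<lambda>f. (restrict f S, f x)"])
        (auto simp: F_def PiE_def extensional_def fun_eq_iff)
    show "(\<lambda>(f, y). f(x := y)) ` Sigma F (\<lambda>f. T - f ` S) \<subseteq> {f \<in> insert x S \<rightarrow>\<^sub>E T. inj_on f (insert x S)}"
      using insert(2) by (auto simp: F_def PiE_iff extensional_def intro!: inj_on_fun_updI split: if_splits)
    show "finite {f \<in> insert x S \<rightarrow>\<^sub>E T. inj_on f (insert x S)}"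
      using insert(1) assms(2) by (simp add: finite_PiE)
  qed
  finally show ?case .
qed simp

lemma bij_betw_closed_walks_5:
  assumes "E \<subseteq> V \<times> V"
  shows "bij_betw (\<lambda>x. (x 0, x 1, x 2, x 3, x 4)) (closed_walks V E 5) (five_cycles E)"
proof (rule bij_betw_byWitness[where f' = "\<lambda>(a, b, c, d, e). \<lambda>i\<in>{..<5}. [a, b, c, d, e] ! i"])
  have less_5: "i < 5 \<longleftrightarrow> i = 0 \<or> i = 1 \<or> i = 2 \<or> i = 3 \<or> i = 4" for i :: nat by auto
  show "\<forall>x\<in>closed_walks V E 5. (case (x 0, x 1, x 2, x 3, x 4) of (a, b, c, d, e) \<Rightarrow> \<lambda>i\<in>{..<5}. [a, b, c, d, e] ! i) = x"
    by (auto simp: closed_walks_def PiE_def extensional_def fun_eq_iff less_5)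
  show "\<forall>D\<in>five_cycles E. (\<lambda>x. (x 0, x 1, x 2, x 3, x 4)) (case D of (a, b, c, d, e) \<Rightarrow> \<lambda>i\<in>{..<5}. [a, b, c, d, e] ! i) = D"
    by auto
  show "(\<lambda>x. (x 0, x 1, x 2, x 3, x 4)) ` closed_walks V E 5 \<subseteq> five_cycles E"
  proof (rule image_subsetI)
    fix x assume "x \<in> closed_walks V E 5"
    then have "(x i, x (Suc i mod 5)) \<in> E" if "i < 5" for i using that by (simp add: closed_walks_def)
    from this[of 0] this[of 1] this[of 2] this[of 3] this[of 4]
    show "(x 0, x 1, x 2, x 3, x 4) \<in> five_cycles E" by (simp add: five_cycles_def numeral_2_eq_2)
  qed
  show "(\<lambda>(a, b, c, d, e). \<lambda>i\<in>{..<5}. [a, b, c, d, e] ! i) ` five_cycles E \<subseteq> closed_walks V E 5"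
  proof (rule image_subsetI)
    fix D assume "D \<in> five_cycles E"
    then obtain a b c d e where D: "D = (a, b, c, d, e)"
      "(a, b) \<in> E" "(b, c) \<in> E" "(c, d) \<in> E" "(d, e) \<in> E" "(e, a) \<in> E"
      by (auto simp: five_cycles_def)
    then have V: "a \<in> V" "b \<in> V" "c \<in> V" "d \<in> V" "e \<in> V" using assms by auto
    have "[a, b, c, d, e] ! i \<in> V \<and> ([a, b, c, d, e] ! i, [a, b, c, d, e] ! (Suc i mod 5)) \<in> E"
      if "i < 5" for i
      using that D V unfolding less_5 by (elim disjE) simp_all
    then show "(case D of (a, b, c, d, e) \<Rightarrow> \<lambda>i\<in>{..<5}. [a, b, c, d, e] ! i) \<in> closed_walks V E 5"
      by (simp add: D(1) closed_walks_def)
  qed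
qed

lemma closed_walks_nonempty:
  assumes "E \<subseteq> V \<times> V" "(w, w) \<in> E ^^ k" "k > 0"
  shows "closed_walks V E k \<noteq> {}"
proof -
  obtain f where f: "f 0 = w" "f k = w" "\<forall>i<k. (f i, f (Suc i)) \<in> E"
    using assms(2) by (auto simp: relpow_fun_conv)
  have "(f i, f (Suc i mod k)) \<in> E" if "i < k" for i
    using f that by (cases "Suc i = k") auto
  then have "restrict f {..<k} \<in> closed_walks V E k"
    using assms(1,3) f(3) by (auto simp: closed_walks_def)
  then show ?thesis by blast
qed

section \<open>Pullbacks along maps from finitely many points\<close>

definition pullback :: "'a rel \<Rightarrow> nat \<Rightarrow> (nat \<Rightarrow> 'a) \<Rightarrow> nat rel" where
  "pullback E m \<phi> = {(i, j). i < m \<and> j < m \<and> (\<phi> i, \<phi> j) \<in> E}"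

text \<open>Both sides express that \<open>\<phi>\<close> after \<open>q\<close> runs along arcs of
  \<open>E\<close>. This allows double counting: fix \<open>\<phi>\<close> and count
  \<open>q\<close>, or fix \<open>q\<close> and count \<open>\<phi>\<close>.\<close>

lemma closed_walks_pullback:
  assumes "\<phi> \<in> {..<m} \<rightarrow>\<^sub>E V"
  shows "q \<in> closed_walks {..<m} (pullback E m \<phi>) k
    \<longleftrightarrow> q \<in> {..<k} \<rightarrow>\<^sub>E {..<m} \<and> \<phi> \<in> pattern_maps V E k {..<m} q"
proof -
  have "Suc i mod k < k" if "i < k" for i
    using that by (intro mod_less_divisor) auto
  then show ?thesis
    using assms by (auto simp: closed_walks_def pattern_maps_def pullback_def PiE_iff)
qed

lemma sum_card_closed_walks_pullback:
  assumes "finite V"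
  shows "(\<Sum>\<phi>\<in>{..<m} \<rightarrow>\<^sub>E V. card (closed_walks {..<m} (pullback E m \<phi>) k))
    = (\<Sum>q\<in>{..<k} \<rightarrow>\<^sub>E {..<m}. card (pattern_maps V E k {..<m} q))"
proof -
  have "(\<Sum>\<phi>\<in>{..<m} \<rightarrow>\<^sub>E V. card (closed_walks {..<m} (pullback E m \<phi>) k))
    = (\<Sum>\<phi>\<in>{..<m} \<rightarrow>\<^sub>E V. \<Sum>q\<in>{..<k} \<rightarrow>\<^sub>E {..<m}. of_bool (\<phi> \<in> pattern_maps V E k {..<m} q))"
  proof (rule sum.cong)
    fix \<phi> assume "\<phi> \<in> {..<m} \<rightarrow>\<^sub>E V"
    then have "closed_walks {..<m} (pullback E m \<phi>) k
        = {q \<in> {..<k} \<rightarrow>\<^sub>E {..<m}. \<phi> \<in> pattern_maps V E k {..<m} q}"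
      using closed_walks_pullback by blast
    then show "card (closed_walks {..<m} (pullback E m \<phi>) k)
        = (\<Sum>q\<in>{..<k} \<rightarrow>\<^sub>E {..<m}. of_bool (\<phi> \<in> pattern_maps V E k {..<m} q))"
      by (simp add: of_bool_def sum.If_cases finite_PiE Int_def)
  qed simp
  also have "\<dots> = (\<Sum>q\<in>{..<k} \<rightarrow>\<^sub>E {..<m}. \<Sum>\<phi>\<in>{..<m} \<rightarrow>\<^sub>E V. of_bool (\<phi> \<in> pattern_maps V E k {..<m} q))"
    by (rule sum.swap)
  also have "\<dots> = (\<Sum>q\<in>{..<k} \<rightarrow>\<^sub>E {..<m}. card (pattern_maps V E k {..<m} q))"
  proof (rule sum.cong)
    fix q
    have "pattern_maps V E k {..<m} q = {\<phi> \<in> {..<m} \<rightarrow>\<^sub>E V. \<phi> \<in> pattern_maps V E k {..<m} q}"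
      by (auto simp: pattern_maps_def)
    then show "(\<Sum>\<phi>\<in>{..<m} \<rightarrow>\<^sub>E V. of_bool (\<phi> \<in> pattern_maps V E k {..<m} q)) = card (pattern_maps V E k {..<m} q)"
      using assms by (simp add: of_bool_def sum.If_cases finite_PiE Int_def)
  qed simp
  finally show ?thesis .
qed

text \<open>A uniformly random map from \<open>m\<close> points to \<open>V\<close> pulls \<open>E\<close> back to a relation which, with
  high probability, has no closed walk of length \<open>l\<close> at all.\<close>

lemma closed_5_walk_density_le:
  assumes V: "finite V" "V \<noteq> {}" "E \<subseteq> V \<times> V"
    and E: "\<And>w. (w, w) \<notin> E" "\<And>u w. (u, w) \<in> E \<Longrightarrow> (w, u) \<notin> E"
    and l: "l > 5" "\<not> 5 dvd l" "l \<notin> {7, 8, 13}"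
    and eps: "\<epsilon> \<ge> 0" "card (closed_walks V E l) / real (card V) ^ l \<le> \<epsilon> ^ 2 ^ l" and m: "m \<ge> 5"
  shows "real (m - 5) ^ 5 * (card (closed_walks V E 5) / real (card V) ^ 5)
    \<le> real m ^ 5 * (1 / 625 + real m ^ l * \<epsilon>)"
proof -
  define n where "n = real (card V)"
  have n: "n > 0" using V by (simp add: n_def card_gt_0_iff)
  define \<Phi> where "\<Phi> = {..<m} \<rightarrow>\<^sub>E V"
  define Bad where "Bad = {\<phi> \<in> \<Phi>. closed_walks {..<m} (pullback E m \<phi>) l \<noteq> {}}"
  have fin\<Phi>: "finite \<Phi>" using V(1) by (simp add: \<Phi>_def finite_PiE)
  have card\<Phi>: "real (card \<Phi>) = n ^ m" by (simp add: \<Phi>_def card_funcsetE n_def)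
  have fin: "finite (closed_walks {..<m} (pullback E m \<phi>) k)" for \<phi> k
    by (rule finite_closed_walks) simp
  have dens: "real (card (pattern_maps V E l {..<m} q)) \<le> \<epsilon> * n ^ m" if "q \<in> {..<l} \<rightarrow>\<^sub>E {..<m}" for q
  proof -
    have "q ` {..<l} \<subseteq> {..<m}" using that by auto
    then have "(card (pattern_maps V E l {..<m} q) / n ^ m) ^ 2 ^ l \<le> \<epsilon> ^ 2 ^ l"
      using pattern_density_le_power[OF V(1,2) E(1), of "{..<m}" q l] eps(2) unfolding n_def by simp
    then have "card (pattern_maps V E l {..<m} q) / n ^ m \<le> \<epsilon>"
      using n eps(1) by (subst (asm) power_mono_iff) auto
    then show ?thesis using n by (simp add: field_simps)
  qed
  \<comment> \<open>Markov's inequality: a bad map has at least one closed walk of length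
    \<open>l\<close>, and the average number is at most \<open>m ^ l * \<epsilon>\<close>.\<close>
  have "card Bad = (\<Sum>\<phi>\<in>Bad. 1)" by simp
  also have "\<dots> \<le> (\<Sum>\<phi>\<in>Bad. card (closed_walks {..<m} (pullback E m \<phi>) l))"
    using fin by (intro sum_mono) (auto simp: Bad_def Suc_le_eq card_gt_0_iff)
  also have "\<dots> \<le> (\<Sum>\<phi>\<in>\<Phi>. card (closed_walks {..<m} (pullback E m \<phi>) l))"
    by (rule sum_mono2[OF fin\<Phi>]) (auto simp: Bad_def)
  finally have "real (card Bad) \<le> real (\<Sum>q\<in>{..<l} \<rightarrow>\<^sub>E {..<m}. card (pattern_maps V E l {..<m} q))"
    unfolding \<Phi>_def sum_card_closed_walks_pullback[OF V(1)] by (simp only: of_nat_le_iff)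
  also have "\<dots> \<le> (\<Sum>q\<in>{..<l} \<rightarrow>\<^sub>E {..<m}. \<epsilon> * n ^ m)"
    unfolding of_nat_sum using dens by (intro sum_mono) simp
  also have "\<dots> = real m ^ l * \<epsilon> * n ^ m" by (simp add: card_funcsetE)
  finally have bad: "real (card Bad) \<le> real m ^ l * \<epsilon> * n ^ m" .
  have good: "real (card (closed_walks {..<m} (pullback E m \<phi>) 5)) \<le> real m ^ 5 / 625" if "\<phi> \<in> \<Phi> - Bad" for \<phi>
  proof -
    have sub: "pullback E m \<phi> \<subseteq> {..<m} \<times> {..<m}" by (auto simp: pullback_def)
    have "closed_walks {..<m} (pullback E m \<phi>) l = {}" using that by (auto simp: Bad_def)
    then interpret oriented_no_closed_walk "pullback E m \<phi>" l
      using E l closed_walks_nonempty[OF sub, of _ l] by unfold_locales (auto simp: pullback_def)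
    show ?thesis
      using card_five_cycles_le[OF _ sub] bij_betw_same_card[OF bij_betw_closed_walks_5[OF sub]] by simp
  qed
  have all: "real (card (closed_walks {..<m} (pullback E m \<phi>) 5)) \<le> real m ^ 5" for \<phi>
  proof -
    have "card (closed_walks {..<m} (pullback E m \<phi>) 5) \<le> card ({..<5::nat} \<rightarrow>\<^sub>E {..<m})"
      by (intro card_mono) (auto simp: finite_PiE closed_walks_def)
    then show ?thesis by (simp add: card_funcsetE flip: of_nat_power)
  qed
  define Inj where "Inj = {q \<in> {..<5::nat} \<rightarrow>\<^sub>E {..<m}. inj_on q {..<5}}"
  \<comment> \<open>Pairs of a map and a closed 5-walk of its pullback are counted twice. From
    below, only injective \<open>q\<close> are kept, at least \<open>(m - 5) ^ 5\<close> of them.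
    From above, good maps obey the sharp bound and bad ones the trivial
    \<open>m ^ 5\<close>.\<close>
  have "real (m - 5) ^ 5 * (card (closed_walks V E 5) / n ^ 5) * n ^ m
      = real (m - 5) ^ 5 * (card (closed_walks V E 5) * n ^ (m - 5))"
    using n m by (simp add: power_diff)
  also have "\<dots> \<le> real (card Inj) * (card (closed_walks V E 5) * n ^ (m - 5))"
    using card_inj_funcset_ge[of "{..<5::nat}" "{..<m}"] n
    by (intro mult_right_mono) (simp_all add: Inj_def flip: of_nat_power)
  also have "\<dots> = real (\<Sum>q\<in>Inj. card (pattern_maps V E 5 {..<m} q))"
  proof -
    have "card (pattern_maps V E 5 {..<m} q) = card (closed_walks V E 5) * card V ^ (m - 5)" if "q \<in> Inj" for q
      using that by (subst card_pattern_maps_inj) (auto simp: Inj_def)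
    then show ?thesis by (simp add: n_def)
  qed
  also have "\<dots> \<le> real (\<Sum>q\<in>{..<5} \<rightarrow>\<^sub>E {..<m}. card (pattern_maps V E 5 {..<m} q))"
    unfolding of_nat_le_iff by (rule sum_mono2) (auto simp: Inj_def finite_PiE)
  also have "\<dots> = (\<Sum>\<phi>\<in>\<Phi>. real (card (closed_walks {..<m} (pullback E m \<phi>) 5)))"
    unfolding \<Phi>_def sum_card_closed_walks_pullback[OF V(1), symmetric] by simp
  also have "\<dots> = (\<Sum>\<phi>\<in>\<Phi> - Bad. real (card (closed_walks {..<m} (pullback E m \<phi>) 5)))
      + (\<Sum>\<phi>\<in>Bad. real (card (closed_walks {..<m} (pullback E m \<phi>) 5)))"
    by (rule sum.subset_diff[OF _ fin\<Phi>]) (auto simp: Bad_def)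
  also have "\<dots> \<le> (\<Sum>\<phi>\<in>\<Phi> - Bad. real m ^ 5 / 625) + (\<Sum>\<phi>\<in>Bad. real m ^ 5)"
    using good all by (intro add_mono sum_mono) auto
  also have "\<dots> = real (card (\<Phi> - Bad)) * (real m ^ 5 / 625) + real (card Bad) * real m ^ 5"
    by simp
  also have "\<dots> \<le> n ^ m * (real m ^ 5 / 625) + (real m ^ l * \<epsilon> * n ^ m) * real m ^ 5"
    using card_mono[OF fin\<Phi>, of "\<Phi> - Bad"] card\<Phi>[symmetric] bad
    by (intro add_mono mult_right_mono) auto
  also have "\<dots> = (real m ^ 5 * (1 / 625 + real m ^ l * \<epsilon>)) * n ^ m"
    by (simp add: algebra_simps)
  finally show ?thesis
    unfolding n_def[symmetric] by (rule mult_right_le_imp_le) (use n in simp)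
qed

section \<open>Copies of directed cycles\<close>

definition cycle_graph :: "nat \<Rightarrow> (nat \<Rightarrow> 'a) \<Rightarrow> 'a pair_pre_digraph" where
  "cycle_graph k x = \<lparr>pverts = x ` {..<k}, parcs = (\<lambda>i. (x i, x (Suc i mod k))) ` {..<k}\<rparr>"

lemma cycle_graph_cong: "(\<And>i. i < k \<Longrightarrow> x i = y i) \<Longrightarrow> cycle_graph k x = cycle_graph k y"
proof -
  assume eq: "\<And>i. i < k \<Longrightarrow> x i = y i"
  have "Suc i mod k < k" if "i < k" for i
    using that by (intro mod_less_divisor) auto
  with eq show ?thesis by (auto simp: cycle_graph_def image_iff)
qed

lemma wf_digraph_oriented_graph:
  assumes "oriented_graph G"
  shows "wf_digraph (with_proj G)"
proof -
  interpret pair_digraph G using assms by (simp add: oriented_graph_def)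
  show ?thesis by unfold_locales
qed

lemma cycle_graph_in_copies:
  assumes G: "oriented_graph G" and x: "x \<in> closed_walks (pverts G) (parcs G) k" "inj_on x {..<k}"
  shows "cycle_graph k x \<in> copies (dcycle k) G"
proof -
  have mod: "Suc i mod k < k" if "i < k" for i
    using that by (intro mod_less_divisor) auto
  have sub: "pverts (cycle_graph k x) \<subseteq> pverts G" "parcs (cycle_graph k x) \<subseteq> parcs G"
    using x(1) by (auto simp: cycle_graph_def closed_walks_def)
  have "wf_digraph (with_proj (cycle_graph k x))"
    using mod by unfold_locales (auto simp: cycle_graph_def)
  then have "subgraph (with_proj (cycle_graph k x)) (with_proj G)"
    using sub wf_digraph_oriented_graph[OF G] by (simp add: subgraph_def compatible_def)
  moreover have "digraph_iso (with_proj (dcycle k)) (with_proj (cycle_graph k x))"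
  proof -
    \<comment> \<open>Both digraphs come from \<open>with_proj\<close>, so the isomorphism has to
      keep \<open>fst\<close> and \<open>snd\<close> as tail and head.\<close>
    define f where "f = \<lparr>iso_verts = x, iso_arcs = map_prod x x, iso_head = snd, iso_tail = fst\<rparr>"
    have arcs: "parcs (dcycle k) = (\<lambda>i. (i, Suc i mod k)) ` {..<k}"
      by (auto simp: dcycle_def)
    have "inj_on (map_prod x x) (parcs (dcycle k))"
      using map_prod_inj_on[OF x(2) x(2)] by (rule inj_on_subset) (auto simp: arcs mod)
    moreover have "wf_digraph (with_proj (dcycle k))"
      using mod by unfold_locales (auto simp: dcycle_def)
    ultimately have "pre_digraph.digraph_isomorphism (with_proj (dcycle k)) f"
      using x(2) by (simp add: pre_digraph.digraph_isomorphism_def f_def) (simp add: dcycle_def)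
    moreover have "with_proj (cycle_graph k x) = app_iso f (with_proj (dcycle k))"
      by (simp add: with_proj_def app_iso_def f_def cycle_graph_def arcs image_image)
        (simp add: dcycle_def)
    ultimately show ?thesis unfolding digraph_iso_def by blast
  qed
  ultimately show ?thesis by (simp add: copies_def)
qed

lemma copies_dcycleE:
  assumes "K \<in> copies (dcycle k) G"
  obtains x where "x \<in> closed_walks (pverts G) (parcs G) k" "inj_on x {..<k}" "K = cycle_graph k x"
proof -
  have mod: "Suc i mod k < k" if "i < k" for i
    using that by (intro mod_less_divisor) auto
  from assms have sub: "pverts K \<subseteq> pverts G" "parcs K \<subseteq> parcs G"
    and iso: "digraph_iso (with_proj (dcycle k)) (with_proj K)"
    by (auto simp: copies_def subgraph_def)
  from iso obtain f where f: "pre_digraph.digraph_isomorphism (with_proj (dcycle k)) f"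
    and K: "with_proj K = app_iso f (with_proj (dcycle k))"
    by (auto simp: digraph_iso_def)
  \<comment> \<open>\<open>app_iso\<close> takes its tail and head functions from \<open>f\<close>,
    so \<open>with_proj K\<close> determines them; the action on arcs then follows from that on
    vertices.\<close>
  have proj: "iso_tail f = fst" "iso_head f = snd"
    using K by (simp_all add: with_proj_def app_iso_def)
  have arcs: "parcs (dcycle k) = (\<lambda>i. (i, Suc i mod k)) ` {..<k}" and verts: "pverts (dcycle k) = {..<k}"
    by (auto simp: dcycle_def)
  have inj: "inj_on (iso_verts f) {..<k}"
    using f by (simp add: pre_digraph.digraph_isomorphism_def verts)
  have "\<forall>a\<in>parcs (dcycle k). iso_arcs f a = (iso_verts f (fst a), iso_verts f (snd a))"
    using f by (simp add: pre_digraph.digraph_isomorphism_def proj)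
  then have "iso_arcs f (i, Suc i mod k) = (iso_verts f i, iso_verts f (Suc i mod k))" if "i < k" for i
    using that by (simp add: arcs)
  then have "parcs K = (\<lambda>i. (iso_verts f i, iso_verts f (Suc i mod k))) ` {..<k}"
    using K by (simp add: with_proj_def app_iso_def arcs image_image)
  moreover have "pverts K = iso_verts f ` {..<k}"
    using K by (simp add: with_proj_def app_iso_def verts)
  ultimately have eq: "K = cycle_graph k (iso_verts f)"
    by (simp add: cycle_graph_def)
  define x where "x = restrict (iso_verts f) {..<k}"
  have "K = cycle_graph k x" unfolding eq by (rule cycle_graph_cong) (simp add: x_def)
  moreover have "x \<in> closed_walks (pverts G) (parcs G) k"
    using sub mod unfolding eq by (auto simp: x_def closed_walks_def cycle_graph_def)
  moreover have "inj_on x {..<k}" using inj by (simp add: x_def inj_on_restrict_eq)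
  ultimately show ?thesis using that by blast
qed

definition rotate_walk :: "nat \<Rightarrow> nat \<Rightarrow> (nat \<Rightarrow> 'a) \<Rightarrow> nat \<Rightarrow> 'a" where
  "rotate_walk k r x = (\<lambda>i\<in>{..<k}. x ((i + r) mod k))"

lemma rotate_walk_in_closed_walks:
  assumes "x \<in> closed_walks V E k"
  shows "rotate_walk k r x \<in> closed_walks V E k"
proof -
  have "(x ((i + r) mod k), x ((Suc i mod k + r) mod k)) \<in> E" if "i < k" for i
  proof -
    have "(i + r) mod k < k" using that by (intro mod_less_divisor) auto
    then have "(x ((i + r) mod k), x (Suc ((i + r) mod k) mod k)) \<in> E"
      using assms by (simp add: closed_walks_def)
    then show ?thesis by (simp add: mod_simps)
  qed
  moreover have "j mod k < k" if "i < k" for i j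
    using that by (intro mod_less_divisor) auto
  ultimately show ?thesis
    using assms by (auto simp: closed_walks_def rotate_walk_def)
qed

lemma cycle_graph_rotate_walk: "cycle_graph k (rotate_walk k r x) = cycle_graph k x"
proof (cases "k = 0")
  case False
  define \<sigma> where "\<sigma> i = (i + r) mod k" for i
  have surj: "\<sigma> ` {..<k} = {..<k}"
  proof
    show "\<sigma> ` {..<k} \<subseteq> {..<k}" using False by (auto simp: \<sigma>_def)
    show "{..<k} \<subseteq> \<sigma> ` {..<k}"
    proof
      fix j assume j: "j \<in> {..<k}"
      \<comment> \<open>The preimage of \<open>j\<close> is \<open>j - r\<close> modulo
        \<open>k\<close>, written so that truncated subtraction does no harm.\<close>
      have "\<sigma> ((j + (k - r mod k)) mod k) = (j + (k - r mod k) + r mod k) mod k"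
        by (simp add: \<sigma>_def mod_simps)
      also have "j + (k - r mod k) + r mod k = j + k"
        using False by (metis add.assoc le_add_diff_inverse2 mod_le_divisor neq0_conv)
      also have "(j + k) mod k = j" using j by simp
      finally show "j \<in> \<sigma> ` {..<k}"
        using False by (intro image_eqI[of _ _ "(j + (k - r mod k)) mod k"]) auto
    qed
  qed
  have "cycle_graph k (rotate_walk k r x)
      = \<lparr>pverts = (x \<circ> \<sigma>) ` {..<k}, parcs = ((\<lambda>i. (x i, x (Suc i mod k))) \<circ> \<sigma>) ` {..<k}\<rparr>"
    using False by (auto simp: cycle_graph_def rotate_walk_def \<sigma>_def mod_simps intro!: image_cong)
  then show ?thesis unfolding image_comp[symmetric] surj by (simp add: cycle_graph_def)
qed (simp add: cycle_graph_def)

text \<open>Choose a closed walk for each copy and take its \<open>k\<close> rotations. Rotation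
  keeps the cycle graph, so the copy can be recovered; the value at 0 then tells the rotation,
  because the chosen walk is injective.\<close>

lemma card_copies_dcycle_le:
  assumes "oriented_graph G"
  shows "k * card (copies (dcycle k) G) \<le> card (closed_walks (pverts G) (parcs G) k)"
proof -
  interpret pair_digraph G using assms by (simp add: oriented_graph_def)
  have "\<forall>K\<in>copies (dcycle k) G. \<exists>x. x \<in> closed_walks (pverts G) (parcs G) k \<and> inj_on x {..<k}
      \<and> cycle_graph k x = K"
    by (metis copies_dcycleE)
  then obtain X where "\<forall>K\<in>copies (dcycle k) G. X K \<in> closed_walks (pverts G) (parcs G) k
      \<and> inj_on (X K) {..<k} \<and> cycle_graph k (X K) = K"
    by (rule bchoice[THEN exE])
  then have X: "X K \<in> closed_walks (pverts G) (parcs G) k" "inj_on (X K) {..<k}" "cycle_graph k (X K) = K"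
    if "K \<in> copies (dcycle k) G" for K
    using that by auto
  have "card (copies (dcycle k) G \<times> {..<k}) \<le> card (closed_walks (pverts G) (parcs G) k)"
  proof (rule card_inj_on_le[where f = "\<lambda>(K, r). rotate_walk k r (X K)"])
    show "finite (closed_walks (pverts G) (parcs G) k)"
      by (rule finite_closed_walks) (rule pair_finite_verts)
    show "(\<lambda>(K, r). rotate_walk k r (X K)) ` (copies (dcycle k) G \<times> {..<k}) \<subseteq> closed_walks (pverts G) (parcs G) k"
      using X(1) rotate_walk_in_closed_walks by fastforce
    show "inj_on (\<lambda>(K, r). rotate_walk k r (X K)) (copies (dcycle k) G \<times> {..<k})"
    proof (rule inj_onI, clarsimp)
      fix K r K' r'
      assume K: "K \<in> copies (dcycle k) G" "K' \<in> copies (dcycle k) G" and r: "r < k" "r' < k"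
        and eq: "rotate_walk k r (X K) = rotate_walk k r' (X K')"
      from arg_cong[OF eq, of "cycle_graph k"] have "K = K'"
        using X(3) K by (simp add: cycle_graph_rotate_walk)
      moreover from this fun_cong[OF eq, of 0] have "X K r = X K r'"
        using r by (simp add: rotate_walk_def)
      ultimately show "K = K' \<and> r = r'" using X(2)[OF K(1)] r by (auto dest: inj_onD)
    qed
  qed
  then show ?thesis by (simp add: card_cartesian_product mult.commute)
qed

section \<open>Bounds for the extremal number\<close>

text \<open>Taking residues modulo 5 as the classes keeps their sizes within 1 of each other for
  every \<open>n\<close>.\<close>

definition cyclic_blowup :: "nat \<Rightarrow> nat pair_pre_digraph" where
  "cyclic_blowup n = \<lparr>pverts = {..<n}, parcs = {(u, v). u < n \<and> v < n \<and> v mod 5 = Suc u mod 5}\<rparr>"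

lemma oriented_cyclic_blowup: "oriented_graph (cyclic_blowup n)"
proof -
  have "finite (parcs (cyclic_blowup n))"
    by (rule finite_subset[of _ "{..<n} \<times> {..<n}"]) (auto simp: cyclic_blowup_def)
  moreover have "Suc u mod 5 \<noteq> u mod 5" for u :: nat by presburger
  then have "u mod 5 \<noteq> Suc u mod 5" for u :: nat by metis
  moreover have "\<not> (v mod 5 = Suc u mod 5 \<and> u mod 5 = Suc v mod 5)" for u v :: nat
  proof
    assume "v mod 5 = Suc u mod 5 \<and> u mod 5 = Suc v mod 5"
    then have "u mod 5 = Suc (Suc u) mod 5" by (metis mod_Suc_eq)
    then show False by presburger
  qed
  ultimately show ?thesis
    unfolding oriented_graph_def by (intro conjI) (unfold_locales, auto simp: cyclic_blowup_def)
qed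

text \<open>Each arc raises the residue modulo 5 by 1, so going once around a cycle of length
  \<open>l\<close> would force \<open>5 dvd l\<close>.\<close>

lemma copies_cyclic_blowup_empty:
  assumes "\<not> 5 dvd l"
  shows "copies (dcycle l) (cyclic_blowup n) = {}"
proof -
  have False if K: "K \<in> copies (dcycle l) (cyclic_blowup n)" for K
  proof -
    have "l > 0" using assms by (intro gr0I) auto
    obtain x where "x \<in> closed_walks (pverts (cyclic_blowup n)) (parcs (cyclic_blowup n)) l"
      using copies_dcycleE[OF K] by metis
    then have arc: "x (Suc i mod l) mod 5 = Suc (x i) mod 5" if "i < l" for i
      using that by (simp add: closed_walks_def cyclic_blowup_def)
    have "x i mod 5 = (x 0 + i) mod 5" if "i < l" for i
      using that
    proof (induction i)
      case (Suc i)
      have "x (Suc i) mod 5 = Suc (x i mod 5) mod 5"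
        using arc[of i] Suc.prems by (simp add: mod_Suc_eq)
      also have "\<dots> = Suc ((x 0 + i) mod 5) mod 5" using Suc by simp
      also have "\<dots> = (x 0 + Suc i) mod 5" by (simp add: mod_Suc_eq)
      finally show ?case .
    qed simp
    from this[of "l - 1"] have 1: "x (l - 1) mod 5 = (x 0 + (l - 1)) mod 5" using \<open>l > 0\<close> by simp
    have "x 0 mod 5 = Suc (x (l - 1) mod 5) mod 5"
      using arc[of "l - 1"] \<open>l > 0\<close> by (simp add: mod_Suc_eq)
    also have "\<dots> = (x 0 + Suc (l - 1)) mod 5" unfolding 1 by (simp add: mod_Suc_eq)
    finally have "x 0 mod 5 = (x 0 + l) mod 5" using \<open>l > 0\<close> by simp
    then have "5 dvd (x 0 + l - x 0)" by (metis le_add1 mod_eq_dvd_iff_nat)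
    then show False using assms by simp
  qed
  then show ?thesis by blast
qed

text \<open>Choose the vertex \<open>5 * f i + i\<close> in class \<open>i\<close>. Its residue
  recovers the position and its quotient recovers \<open>f i\<close>, so different choices span
  different cycles.\<close>

lemma card_copies_cyclic_blowup: "(n div 5) ^ 5 \<le> card (copies (dcycle 5) (cyclic_blowup n))"
proof -
  define x where "x f = (\<lambda>i\<in>{..<5}. 5 * f i + i)" for f :: "nat \<Rightarrow> nat"
  let ?F = "{..<5::nat} \<rightarrow>\<^sub>E {..<n div 5}"
  have mod: "x f i mod 5 = i" "x f i div 5 = f i" if "i < 5" for f i
    using that by (simp_all add: x_def)
  have "(n div 5) ^ 5 = card ?F" by (simp add: card_funcsetE)
  also have "\<dots> \<le> card (copies (dcycle 5) (cyclic_blowup n))"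
  proof (rule card_inj_on_le[where f = "\<lambda>f. cycle_graph 5 (x f)"])
    show "finite (copies (dcycle 5) (cyclic_blowup n))"
      by (rule finite_copies[OF oriented_cyclic_blowup])
    show "inj_on (\<lambda>f. cycle_graph 5 (x f)) ?F"
    proof (rule inj_onI)
      fix f g assume f: "f \<in> ?F" and g: "g \<in> ?F" and eq: "cycle_graph 5 (x f) = cycle_graph 5 (x g)"
      show "f = g"
      proof (rule PiE_ext[OF f g])
        fix i :: nat assume "i \<in> {..<5}"
        then have i: "i < 5" by simp
        have "x f i \<in> x g ` {..<5}" using eq i by (auto simp: cycle_graph_def)
        then obtain j where "j < 5" "x f i = x g j" by auto
        with i mod[of i f] mod[of j g] show "f i = g i" by simp
      qed
    qed
    show "(\<lambda>f. cycle_graph 5 (x f)) ` ?F \<subseteq> copies (dcycle 5) (cyclic_blowup n)"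
    proof (rule image_subsetI, rule cycle_graph_in_copies[OF oriented_cyclic_blowup])
      fix f assume f: "f \<in> ?F"
      have less: "x f i < n" if "i < 5" for i
      proof -
        have "f i < n div 5" using f that by auto
        then show ?thesis using that by (simp add: x_def)
      qed
      have m: "x f (Suc i mod 5) mod 5 = Suc (x f i) mod 5" if "i < 5" for i
      proof -
        have "x f (Suc i mod 5) mod 5 = Suc i mod 5" by (rule mod) simp
        also have "\<dots> = Suc (x f i mod 5) mod 5" using mod(1)[OF that] by simp
        finally show ?thesis by (simp add: mod_simps)
      qed
      have "x f \<in> {..<5} \<rightarrow>\<^sub>E {..<n}"
        using less by (auto simp: PiE_iff) (simp add: x_def)
      then show "x f \<in> closed_walks (pverts (cyclic_blowup n)) (parcs (cyclic_blowup n)) 5"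
        using less m by (simp add: closed_walks_def cyclic_blowup_def)
      show "inj_on (x f) {..<5}"
        using mod(1)[of _ f] by (intro inj_on_inverseI[where g = "\<lambda>y. y mod 5"]) auto
    qed
  qed
  finally show ?thesis .
qed

text \<open>An injective closed walk of length \<open>l\<close> would span a forbidden cycle, so all
  closed walks are among the non-injective maps, of which there are at most
  \<open>n ^ l - (n - l) ^ l\<close>.\<close>

lemma closed_walk_density_le:
  assumes G: "oriented_graph G" and free: "copies (dcycle l) G = {}" and n: "card (pverts G) = n" "n \<ge> l" "n > 0"
  shows "card (closed_walks (pverts G) (parcs G) l) / real n ^ l \<le> 1 - (1 - real l / real n) ^ l"
proof -
  interpret pair_digraph G using G by (simp add: oriented_graph_def)
  define Inj where "Inj = {f \<in> {..<l} \<rightarrow>\<^sub>E pverts G. inj_on f {..<l}}"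
  have fin: "finite ({..<l} \<rightarrow>\<^sub>E pverts G)" using pair_finite_verts by (simp add: finite_PiE)
  have "closed_walks (pverts G) (parcs G) l \<subseteq> ({..<l} \<rightarrow>\<^sub>E pverts G) - Inj"
    using cycle_graph_in_copies[OF G] free by (auto simp: Inj_def closed_walks_def)
  then have "card (closed_walks (pverts G) (parcs G) l) \<le> card (({..<l} \<rightarrow>\<^sub>E pverts G) - Inj)"
    using fin by (intro card_mono) auto
  also have "\<dots> = n ^ l - card Inj"
    using fin n(1) by (subst card_Diff_subset) (auto simp: Inj_def card_funcsetE intro: finite_subset[OF _ fin])
  also have "\<dots> \<le> n ^ l - (n - l) ^ l"
    using card_inj_funcset_ge[of "{..<l}" "pverts G"] pair_finite_verts n(1) by (simp add: Inj_def)
  finally have "real (card (closed_walks (pverts G) (parcs G) l)) \<le> real (n ^ l - (n - l) ^ l)"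
    by (simp only: of_nat_le_iff)
  also have "\<dots> = real n ^ l - (real n - real l) ^ l"
    using n by (simp add: of_nat_diff power_mono)
  finally have "card (closed_walks (pverts G) (parcs G) l) / real n ^ l
      \<le> (real n ^ l - (real n - real l) ^ l) / real n ^ l"
    by (rule divide_right_mono) simp
  also have "\<dots> = 1 - (1 - real l / real n) ^ l"
    using n(3) by (simp add: diff_divide_distrib power_divide[symmetric])
  finally show ?thesis .
qed

lemma ex_oriented_lower_bound:
  assumes "\<not> 5 dvd l"
  shows "(n div 5) ^ 5 \<le> ex_oriented n (dcycle 5) (dcycle l)"
proof -
  have "card (copies (dcycle 5) (cyclic_blowup n)) \<in> copy_counts n (dcycle 5) (dcycle l)"
    using oriented_cyclic_blowup[of n] copies_cyclic_blowup_empty[OF assms, of n]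
    unfolding copy_counts_def
    by (intro CollectI exI[of _ "cyclic_blowup n"]) (simp add: cyclic_blowup_def)
  then have "card (copies (dcycle 5) (cyclic_blowup n)) \<le> ex_oriented n (dcycle 5) (dcycle l)"
    unfolding ex_oriented_def by (intro Max_ge finite_copy_counts)
  with card_copies_cyclic_blowup show ?thesis by (rule order.trans)
qed

text \<open>The 5 on the left stands for the five rotations of each copy. The factor with
  \<open>m - 5\<close> is the price of keeping only injective patterns, and the term with
  \<open>\<epsilon>\<close> that of the bad maps.\<close>

lemma ex_oriented_upper_bound:
  assumes l: "l > 5" "\<not> 5 dvd l" "l \<notin> {7, 8, 13}" and n: "n \<ge> l" and m: "m > 5"
    and eps: "\<epsilon> \<ge> 0" "1 - (1 - real l / real n) ^ l \<le> \<epsilon> ^ 2 ^ l"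
  shows "5 * real (ex_oriented n (dcycle 5) (dcycle l))
    \<le> (real m / real (m - 5)) ^ 5 * (1 / 625 + real m ^ l * \<epsilon>) * real n ^ 5"
proof -
  have "parcs (dcycle l) \<noteq> {}" using l(1) by (auto simp: dcycle_def)
  then have "ex_oriented n (dcycle 5) (dcycle l) \<in> copy_counts n (dcycle 5) (dcycle l)"
    unfolding ex_oriented_def by (intro Max_in finite_copy_counts copy_counts_nonempty)
  then obtain G :: "nat pair_pre_digraph" where G: "oriented_graph G" "card (pverts G) = n" "copies (dcycle l) G = {}"
    and ex: "ex_oriented n (dcycle 5) (dcycle l) = card (copies (dcycle 5) G)"
    by (auto simp: copy_counts_def)
  interpret pair_digraph G using G(1) by (simp add: oriented_graph_def)
  have n0: "n > 0" using n l(1) by simp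
  have V: "finite (pverts G)" "pverts G \<noteq> {}" "parcs G \<subseteq> pverts G \<times> pverts G"
    using pair_finite_verts G(2) n0 arc_fst_in_verts arc_snd_in_verts by fastforce+
  have E: "(w, w) \<notin> parcs G" "(u, w) \<in> parcs G \<Longrightarrow> (w, u) \<notin> parcs G" for u w
    using G(1) by (auto simp: oriented_graph_def)
  have "card (closed_walks (pverts G) (parcs G) l) / real (card (pverts G)) ^ l \<le> \<epsilon> ^ 2 ^ l"
    using closed_walk_density_le[OF G(1,3,2) n n0] eps(2) G(2) by simp
  then have "real (m - 5) ^ 5 * (card (closed_walks (pverts G) (parcs G) 5) / real n ^ 5)
      \<le> real m ^ 5 * (1 / 625 + real m ^ l * \<epsilon>)"
    using closed_5_walk_density_le[OF V E l eps(1), of m] m G(2) by simp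
  then have "card (closed_walks (pverts G) (parcs G) 5)
      \<le> (real m / real (m - 5)) ^ 5 * (1 / 625 + real m ^ l * \<epsilon>) * real n ^ 5"
    using m n0 by (simp add: power_divide field_simps)
  moreover have "real (5 * card (copies (dcycle 5) G)) \<le> real (card (closed_walks (pverts G) (parcs G) 5))"
    using card_copies_dcycle_le[OF G(1), of 5] by (simp only: of_nat_le_iff)
  ultimately show ?thesis by (simp add: ex)
qed

theorem theorem3p13:
  fixes l :: nat
  assumes "l > 5" and "\<not> 5 dvd l" and "l \<notin> {7, 8, 13}"
  shows "(\<lambda>n. real (ex_oriented n (dcycle 5) (dcycle l)) - (real n / 5) ^ 5)
           \<in> o(\<lambda>n. real n ^ 5)"
proof (rule landau_o.smallI)
  fix c :: real
  assume c: "c > 0"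
  let ?ex = "\<lambda>n. real (ex_oriented n (dcycle 5) (dcycle l))"
  \<comment> \<open>The order of choices is essential: first \<open>m\<close>, to bring the main
    term close to \<open>1 / 625\<close>; then \<open>\<epsilon>\<close>, small in terms of
    \<open>m\<close>; finally \<open>n\<close> large in terms of both.\<close>
  have "(\<lambda>m. inverse (1 - 5 / real m) ^ 5 * (1 / 625)) \<longlonglongrightarrow> inverse (1 - 0) ^ 5 * (1 / 625)"
    by (intro tendsto_intros lim_const_over_n) auto
  then have "\<forall>\<^sub>F m in sequentially. inverse (1 - 5 / real m) ^ 5 * (1 / 625) < 1 / 625 + c"
    by (rule order_tendstoD) (use c in simp)
  then have "\<forall>\<^sub>F m in sequentially. m > 5 \<and> inverse (1 - 5 / real m) ^ 5 * (1 / 625) < 1 / 625 + c"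
    using eventually_gt_at_top[of 5] by eventually_elim simp
  then obtain m where m: "m > 5" "inverse (1 - 5 / real m) ^ 5 * (1 / 625) < 1 / 625 + c"
    by (auto dest: eventually_happens)
  define K where "K = (real m / real (m - 5)) ^ 5"
  have K: "K > 0" "K / 625 < 1 / 625 + c"
  proof -
    have "inverse (1 - 5 / real m) = real m / real (m - 5)"
      using m(1) by (simp add: field_simps of_nat_diff)
    with m show "K / 625 < 1 / 625 + c" by (simp add: K_def)
    show "K > 0" using m(1) by (simp add: K_def)
  qed
  define \<epsilon> where "\<epsilon> = c / (K * real m ^ l)"
  have eps: "\<epsilon> > 0" "K * (real m ^ l * \<epsilon>) = c" using c K m(1) by (simp_all add: \<epsilon>_def)
  have "(\<lambda>n. 1 - (1 - real l / real n) ^ l) \<longlonglongrightarrow> 1 - (1 - 0) ^ l"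
    by (intro tendsto_intros lim_const_over_n)
  then have "\<forall>\<^sub>F n in sequentially. 1 - (1 - real l / real n) ^ l < \<epsilon> ^ 2 ^ l"
    by (rule order_tendstoD) (use eps in simp)
  then have upper: "\<forall>\<^sub>F n in sequentially. ?ex n \<le> (real n / 5) ^ 5 + c * real n ^ 5"
    using eventually_ge_at_top[of l]
  proof eventually_elim
    case (elim n)
    have "5 * ?ex n \<le> K * (1 / 625 + real m ^ l * \<epsilon>) * real n ^ 5"
      unfolding K_def using elim eps(1) by (intro ex_oriented_upper_bound assms m(1)) auto
    also have "K * (1 / 625 + real m ^ l * \<epsilon>) = K / 625 + c" using eps(2) by (simp add: algebra_simps)
    \<comment> \<open>The left factor is below \<open>1 / 625 + 2 * c\<close>; it is relaxed to
      \<open>5 * c\<close> so that dividing by 5 leaves the error \<open>c\<close>.\<close>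
    also have "(K / 625 + c) * real n ^ 5 \<le> (1 / 625 + 5 * c) * real n ^ 5"
      using K(2) c by (intro mult_right_mono) auto
    finally show ?case by (simp add: power_divide algebra_simps)
  qed
  \<comment> \<open>Rounding costs little: \<open>n div 5\<close> is at least
    \<open>(n - 4) / 5\<close>, that is, \<open>n / 5\<close> times
    \<open>1 - 4 / n\<close>.\<close>
  have "(\<lambda>n. (1 - 4 / real n) ^ 5) \<longlonglongrightarrow> (1 - 0) ^ 5"
    by (intro tendsto_intros lim_const_over_n)
  then have "\<forall>\<^sub>F n in sequentially. 1 - c < (1 - 4 / real n) ^ 5"
    by (rule order_tendstoD) (use c in simp)
  then have lower: "\<forall>\<^sub>F n in sequentially. (real n / 5) ^ 5 - c * real n ^ 5 \<le> ?ex n"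
    using eventually_ge_at_top[of 4]
  proof eventually_elim
    case (elim n)
    have "(real n / 5) ^ 5 - c * real n ^ 5 \<le> (1 - c) * (real n / 5) ^ 5"
      using c by (simp add: power_divide algebra_simps)
    also have "\<dots> \<le> (1 - 4 / real n) ^ 5 * (real n / 5) ^ 5"
      using elim by (intro mult_right_mono) auto
    also have "\<dots> = ((real n - 4) / 5) ^ 5"
      using elim by (simp add: power_mult_distrib[symmetric] field_simps)
    also have "\<dots> \<le> real (n div 5) ^ 5"
    proof (rule power_mono)
      have "n \<le> 5 * (n div 5) + 4" by presburger
      then have "real n \<le> real (5 * (n div 5) + 4)" by (simp only: of_nat_le_iff)
      then show "(real n - 4) / 5 \<le> real (n div 5)" by (simp only: of_nat_add of_nat_mult of_nat_numeral) argo
    qed (use elim in simp)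
    also have "\<dots> \<le> ?ex n"
      using ex_oriented_lower_bound[OF assms(2), of n] by (metis of_nat_le_iff of_nat_power)
    finally show ?case .
  qed
  from upper lower
  show "\<forall>\<^sub>F n in sequentially. norm (?ex n - (real n / 5) ^ 5) \<le> c * norm (real n ^ 5)"
    by eventually_elim (simp add: abs_le_iff)
qed

end
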